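(* Let $T$ be a complete first order theory and let $\lambda\ge\kappa=\mathrm{cf}(\kappa)$ be infinite cardinals such that $2^{\min\{2^\kappa,\lambda\}}>\lambda^\kappa$ and $\lambda>|T|$. (1) If $T$ has the strong independence property, then $\mathrm{Pr}_{\lambda,\kappa}(T)$. (2) If $T$ is independent, then $\mathrm{Pr}_{\lambda,\kappa}(T)$.
   Context: $\mathrm{EC}(T)$ is the class of models of $T$ and $\mathrm{EC}_\lambda(T)$ the class of models of $T$ of cardinality $\lambda$; $\prec$ is elementary submodel. $S^{\lambda^+}_\mu=\{\delta<\lambda^+:\mathrm{cf}(\delta)=\mu\}$. Strong independence property: for some formula $\varphi(\bar x,y)$ in the language of $T$, for every $M\in\mathrm{EC}(T)$, every $n$ and all pairwise distinct $a_0,\dots,a_{2n-1}\in M$ there is a tuple $\bar a$ from $M$ such that for every $\ell<2n$: $M\models\varphi[\bar a,a_\ell]$ if $\ell$ is even and $M\models\neg\varphi[\bar a,a_\ell]$ if $\ell$ is odd. $T$ is independent when there is a formula $\varphi(x,\bar y)$ such that for every $n$ and $M\models T$ there are tuples $\bar a_\ell$ ($\ell<n$) from $M$ such that for every $u\subseteq\{0,\dots,n-1\}$, $M\models(\exists x)\big[\bigwedge_{\ell\in u}\varphi(x,\bar a_\ell)\wedge\bigwedge_{\ell<n,\ \ell\notin u}\neg\varphi(x,\bar a_\ell)\big]$. $\mathrm{Pr}_{\lambda,\kappa}(\bar M)$ means: $\bar M=\langle M_\alpha:\alpha<\lambda^+\rangle$ is $\prec$-increasing continuous, each $M_\alpha$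 has cardinality $\lambda$, and for some club $E$ of $\lambda^+$: if $\alpha\in S^{\lambda^+}_\lambda\cap E$, $\delta_1,\delta_2\in S^{\lambda^+}_\kappa\cap E$ and $\alpha<\delta_1<\delta_2$, then there is no automorphism $\pi$ of $M_\alpha$ which maps $\{\mathrm{tp}(\bar a,M_\alpha,M_{\delta_1}):\bar a\in{}^{\omega>}(M_{\delta_1})\}$ onto $\{\mathrm{tp}(\bar a,M_\alpha,M_{\delta_2}):\bar a\in{}^{\omega>}(M_{\delta_2})\}$. Here $\mathrm{tp}(\bar a,M_\alpha,M_\delta)$ is the complete type of $\bar a$ over $M_\alpha$ in $M_\delta$, ${}^{\omega>}A$ is the set of finite sequences from $A$, and $\pi$ acts on types over $M_\alpha$ by acting on the parameters. $\mathrm{Pr}_{\lambda,\kappa}(T)$ means: there is a function $\mathbf F$ assigning to each $\prec$-increasing continuous sequence $\langle M_j:j\le i\rangle$ ($i<\lambda^+$) of members of $\mathrm{EC}_\lambda(T)$ a model $\mathbf F(\langle M_j:j\le i\rangle)\in\mathrm{EC}_\lambda(T)$ with $M_i\prec\mathbf F(\langle M_j:j\le i\rangle)$, such that $\mathrm{Pr}_{\lambda,\kappa}(\bar M)$ holds for every $\prec$-increasing continuous sequence $\bar M=\langle M_\alpha:\alpha<\lambda^+\rangle$ of members of $\mathrm{EC}_\lambda(T)$ which obeys $\mathbf F$, i.e. satisfies $M_{i+1}\prec\mathbf F(\langle M_j:j\le i+1\rangle)\prec M_{i+2}$ for every $i<\lambda^+$. (One assumes global choice, or restricts to models whose universe is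 an ordinal in $[\lambda,\lambda^+)$.) *)

theory Defs
  imports Main "HOL-Library.FuncSet"
begin

unbundle cardinal_syntax

section \<open>First-order logic\<close>

text \<open>
  A vocabulary is a set of function symbols and a set of relation symbols with arities; constants
  are the function symbols of arity 0. Either of the two sets may be empty, and there is no
  restriction on their cardinalities.
\<close>

record ('f, 'r) vocab =
  fsyms :: "'f set"
  far   :: "'f \<Rightarrow> nat"
  rsyms :: "'r set"
  rar   :: "'r \<Rightarrow> nat"

datatype 'f tm = Var nat | App 'f "'f tm list"

datatype ('f, 'r) fm =
    Eq "'f tm" "'f tm"
  | Rel 'r "'f tm list"
  | Neg "('f, 'r) fm"
  | Con "('f, 'r) fm" "('f, 'r) fm"
  | Ex nat "('f, 'r) fm"

primrec tm_over :: "('f, 'r) vocab \<Rightarrow> 'f tm \<Rightarrow> bool" where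
  "tm_over V (Var n) \<longleftrightarrow> True"
| "tm_over V (App f ts) \<longleftrightarrow> f \<in> fsyms V \<and> length ts = far V f \<and> list_all (tm_over V) ts"

primrec fm_over :: "('f, 'r) vocab \<Rightarrow> ('f, 'r) fm \<Rightarrow> bool" where
  "fm_over V (Eq s t) \<longleftrightarrow> tm_over V s \<and> tm_over V t"
| "fm_over V (Rel R ts) \<longleftrightarrow> R \<in> rsyms V \<and> length ts = rar V R \<and> list_all (tm_over V) ts"
| "fm_over V (Neg p) \<longleftrightarrow> fm_over V p"
| "fm_over V (Con p q) \<longleftrightarrow> fm_over V p \<and> fm_over V q"
| "fm_over V (Ex n p) \<longleftrightarrow> fm_over V p"

primrec fv_tm :: "'f tm \<Rightarrow> nat set" where
  "fv_tm (Var n) = {n}"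
| "fv_tm (App f ts) = \<Union> (set (map fv_tm ts))"

primrec fv :: "('f, 'r) fm \<Rightarrow> nat set" where
  "fv (Eq s t) = fv_tm s \<union> fv_tm t"
| "fv (Rel R ts) = \<Union> (set (map fv_tm ts))"
| "fv (Neg p) = fv p"
| "fv (Con p q) = fv p \<union> fv q"
| "fv (Ex n p) = fv p - {n}"

text \<open>
  The formulas whose free variables are among \<open>x\<^sub>0, \<dots>, x\<^bsub>k-1\<^esub>\<close>. A formula with a displayed
  list of variables, such as \<open>\<phi>(x, y\<^sub>0, \<dots>, y\<^bsub>m-1\<^esub>)\<close>, is one in \<open>formulas V (Suc m)\<close>, the variables
  being numbered in the order in which they are displayed.
\<close>

definition formulas :: "('f, 'r) vocab \<Rightarrow> nat \<Rightarrow> ('f, 'r) fm set" where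
  "formulas V k = {p. fm_over V p \<and> fv p \<subseteq> {..<k}}"

abbreviation sentences :: "('f, 'r) vocab \<Rightarrow> ('f, 'r) fm set" where
  "sentences V \<equiv> formulas V 0"

text \<open>
  Only the values of \<open>fint\<close> and \<open>rint\<close> at symbols of the vocabulary and at tuples of the right
  length from the universe are meaningful; none of the notions below depends on the others.
\<close>

record ('f, 'r, 'a) struct =
  univ :: "'a set"
  fint :: "'f \<Rightarrow> 'a list \<Rightarrow> 'a"
  rint :: "'r \<Rightarrow> 'a list \<Rightarrow> bool"

definition is_struct :: "('f, 'r) vocab \<Rightarrow> ('f, 'r, 'a) struct \<Rightarrow> bool" where
  "is_struct V M \<longleftrightarrow> univ M \<noteq> {} \<and>
     (\<forall>f \<in> fsyms V. \<forall>as \<in> lists (univ M). length as = far V f \<longrightarrow> fint M f as \<in> univ M)"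

primrec val :: "('f, 'r, 'a) struct \<Rightarrow> (nat \<Rightarrow> 'a) \<Rightarrow> 'f tm \<Rightarrow> 'a" where
  "val M e (Var n) = e n"
| "val M e (App f ts) = fint M f (map (val M e) ts)"

primrec sat :: "('f, 'r, 'a) struct \<Rightarrow> (nat \<Rightarrow> 'a) \<Rightarrow> ('f, 'r) fm \<Rightarrow> bool" where
  "sat M e (Eq s t) \<longleftrightarrow> val M e s = val M e t"
| "sat M e (Rel R ts) \<longleftrightarrow> rint M R (map (val M e) ts)"
| "sat M e (Neg p) \<longleftrightarrow> \<not> sat M e p"
| "sat M e (Con p q) \<longleftrightarrow> sat M e p \<and> sat M e q"
| "sat M e (Ex n p) \<longleftrightarrow> (\<exists>a \<in> univ M. sat M (e(n := a)) p)"

text \<open>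
  \<open>M \<Turnstile> p[a\<^sub>0, \<dots>, a\<^bsub>k-1\<^esub>]\<close>. It is only used for \<open>p \<in> formulas V k\<close> with \<open>k\<close> the length of the
  list, where the unspecified values of \<open>(!) as\<close> beyond the length of \<open>as\<close> are irrelevant.
\<close>

definition holds :: "('f, 'r, 'a) struct \<Rightarrow> ('f, 'r) fm \<Rightarrow> 'a list \<Rightarrow> bool" where
  "holds M p as \<longleftrightarrow> sat M ((!) as) p"

definition EC :: "('f, 'r) vocab \<Rightarrow> ('f, 'r) fm set \<Rightarrow> ('f, 'r, 'a) struct set" where
  "EC V T = {M. is_struct V M \<and> (\<forall>p \<in> T. holds M p [])}"

definition EC_card ::
  "('f, 'r) vocab \<Rightarrow> ('f, 'r) fm set \<Rightarrow> 'l rel \<Rightarrow> ('f, 'r, 'a) struct set" where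
  "EC_card V T lam = {M \<in> EC V T. |univ M| =o lam}"

text \<open>
  The notions that quantify over all models of a theory take the type \<open>'a\<close> of the elements of the
  models as an argument, since HOL has no quantification over types. By the
  Loewenheim-Skolem theorems, \<open>complete_theory\<close> does not depend on \<open>'a\<close> as long as \<open>'a\<close> is infinite
  and of cardinality at least that of \<open>T\<close>; the same holds for the two independence properties
  of complete \<open>T\<close>.
\<close>

definition complete_theory :: "'a itself \<Rightarrow> ('f, 'r) vocab \<Rightarrow> ('f, 'r) fm set \<Rightarrow> bool" where
  "complete_theory (_ :: 'a itself) V T \<longleftrightarrow>
     T \<subseteq> sentences V \<and>
     (EC V T :: ('f, 'r, 'a) struct set) \<noteq> {} \<and>
     (\<forall>p \<in> sentences V.
        (\<forall>M \<in> (EC V T :: ('f, 'r, 'a) struct set). holds M p []) \<or>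
        (\<forall>M \<in> (EC V T :: ('f, 'r, 'a) struct set). holds M (Neg p) []))"

definition submodel ::
  "('f, 'r) vocab \<Rightarrow> ('f, 'r, 'a) struct \<Rightarrow> ('f, 'r, 'a) struct \<Rightarrow> bool" where
  "submodel V M N \<longleftrightarrow> is_struct V M \<and> is_struct V N \<and> univ M \<subseteq> univ N \<and>
     (\<forall>f \<in> fsyms V. \<forall>as \<in> lists (univ M). length as = far V f \<longrightarrow> fint M f as = fint N f as) \<and>
     (\<forall>R \<in> rsyms V. \<forall>as \<in> lists (univ M). length as = rar V R \<longrightarrow> rint M R as = rint N R as)"

definition elem_submodel ::
  "('f, 'r) vocab \<Rightarrow> ('f, 'r, 'a) struct \<Rightarrow> ('f, 'r, 'a) struct \<Rightarrow> bool" where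
  "elem_submodel V M N \<longleftrightarrow> submodel V M N \<and>
     (\<forall>as \<in> lists (univ M). \<forall>p \<in> formulas V (length as). holds M p as \<longleftrightarrow> holds N p as)"

definition automorphism ::
  "('f, 'r) vocab \<Rightarrow> ('f, 'r, 'a) struct \<Rightarrow> ('a \<Rightarrow> 'a) \<Rightarrow> bool" where
  "automorphism V M \<pi> \<longleftrightarrow> bij_betw \<pi> (univ M) (univ M) \<and>
     (\<forall>f \<in> fsyms V. \<forall>as \<in> lists (univ M). length as = far V f \<longrightarrow>
        \<pi> (fint M f as) = fint M f (map \<pi> as)) \<and>
     (\<forall>R \<in> rsyms V. \<forall>as \<in> lists (univ M). length as = rar V R \<longrightarrow>
        rint M R as = rint M R (map \<pi> as))"

text \<open>
  The pair \<open>(p, bs)\<close> stands for the formula \<open>p(x\<^sub>0, \<dots>, x\<^bsub>n-1\<^esub>, bs)\<close> with parameters \<open>bs\<close>, where \<open>n\<close>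
  is the length of the tuple realizing the type. The type determines \<open>n\<close>: the pair
  \<open>(x\<^sub>i = x\<^sub>i, [])\<close> belongs to it iff \<open>i < n\<close>.
\<close>

definition tp :: "('f, 'r) vocab \<Rightarrow> 'a list \<Rightarrow> 'a set \<Rightarrow> ('f, 'r, 'a) struct \<Rightarrow>
    (('f, 'r) fm \<times> 'a list) set" where
  "tp V as A N =
     {(p, bs). bs \<in> lists A \<and> p \<in> formulas V (length as + length bs) \<and> holds N p (as @ bs)}"

definition move_tp :: "('a \<Rightarrow> 'a) \<Rightarrow> (('f, 'r) fm \<times> 'a list) set \<Rightarrow> (('f, 'r) fm \<times> 'a list) set"
  where "move_tp \<pi> t = (\<lambda>(p, bs). (p, map \<pi> bs)) ` t"

definition realized_tps :: "('f, 'r) vocab \<Rightarrow> ('f, 'r, 'a) struct \<Rightarrow> ('f, 'r, 'a) struct \<Rightarrow>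
    (('f, 'r) fm \<times> 'a list) set set" where
  "realized_tps V M N = {tp V as (univ M) N | as. as \<in> lists (univ N)}"

definition strong_independence_property ::
  "'a itself \<Rightarrow> ('f, 'r) vocab \<Rightarrow> ('f, 'r) fm set \<Rightarrow> bool" where
  "strong_independence_property (_ :: 'a itself) V T \<longleftrightarrow>
     (\<exists>m. \<exists>\<phi> \<in> formulas V (Suc m).
        \<forall>M \<in> (EC V T :: ('f, 'r, 'a) struct set). \<forall>n. \<forall>a :: nat \<Rightarrow> 'a.
          a ` {..<2*n} \<subseteq> univ M \<and> inj_on a {..<2*n} \<longrightarrow>
          (\<exists>as \<in> lists (univ M). length as = m \<and>
             (\<forall>l < 2*n. (even l \<longrightarrow> holds M \<phi> (as @ [a l])) \<and>
                        (odd l \<longrightarrow> holds M (Neg \<phi>) (as @ [a l])))))"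

definition independent_theory ::
  "'a itself \<Rightarrow> ('f, 'r) vocab \<Rightarrow> ('f, 'r) fm set \<Rightarrow> bool" where
  "independent_theory (_ :: 'a itself) V T \<longleftrightarrow>
     (\<exists>m. \<exists>\<phi> \<in> formulas V (Suc m).
        \<forall>n. \<forall>M \<in> (EC V T :: ('f, 'r, 'a) struct set). \<exists>b :: nat \<Rightarrow> 'a list.
          (\<forall>l < n. b l \<in> lists (univ M) \<and> length (b l) = m) \<and>
          (\<forall>u \<subseteq> {..<n}. \<exists>x \<in> univ M.
             (\<forall>l \<in> u. holds M \<phi> (x # b l)) \<and>
             (\<forall>l < n. l \<notin> u \<longrightarrow> holds M (Neg \<phi>) (x # b l))))"

section \<open>Ordinals and cardinals\<close>

text \<open>
  Cardinals are the cardinal orders of the library. For a cardinal order \<open>lam\<close>, the ordinals below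
  \<open>lam\<^sup>+\<close> are represented by the elements of \<open>Field (cardSuc lam)\<close>, in the order \<open>cardSuc lam\<close>; below,
  \<open>r\<close> is a well-order and its elements play the role of ordinals.
\<close>

definition cmin :: "'a rel \<Rightarrow> 'b rel \<Rightarrow> ('a + 'b) rel" where
  "cmin r s = (if r \<le>o s then |Inl ` Field r| else |Inr ` Field s| )"

definition osuc :: "'i rel \<Rightarrow> 'i \<Rightarrow> 'i" where
  "osuc r i = wo_rel.suc r {i}"

definition is_limit :: "'i rel \<Rightarrow> 'i \<Rightarrow> bool" where
  "is_limit r \<delta> \<longleftrightarrow> underS r \<delta> \<noteq> {} \<and> (\<forall>i \<in> underS r \<delta>. \<exists>j \<in> underS r \<delta>. i \<in> underS r j)"

text \<open>
  The library predicate \<open>cofinal\<close> is strict, so \<open>has_cof\<close> gives no cofinality to successors;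
  it is only used with infinite \<open>\<mu>\<close>.
\<close>

definition has_cof :: "'i rel \<Rightarrow> 'i \<Rightarrow> 'm rel \<Rightarrow> bool" where
  "has_cof r \<delta> \<mu> \<longleftrightarrow>
     (\<exists>K \<subseteq> underS r \<delta>. cofinal K (Restr r (underS r \<delta>)) \<and> |K| =o \<mu>) \<and>
     (\<forall>K \<subseteq> underS r \<delta>. cofinal K (Restr r (underS r \<delta>)) \<longrightarrow> \<mu> \<le>o |K| )"

definition cof_points :: "'i rel \<Rightarrow> 'm rel \<Rightarrow> 'i set" where
  "cof_points r \<mu> = {\<delta> \<in> Field r. has_cof r \<delta> \<mu>}"

definition club :: "'i rel \<Rightarrow> 'i set \<Rightarrow> bool" where
  "club r E \<longleftrightarrow> E \<subseteq> Field r \<and> cofinal E r \<and>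
     (\<forall>\<delta> \<in> Field r. is_limit r \<delta> \<and> (\<forall>i \<in> underS r \<delta>. \<exists>j \<in> E \<inter> underS r \<delta>. i \<in> underS r j)
        \<longrightarrow> \<delta> \<in> E)"

section \<open>The property Pr\<close>

text \<open>
  \<open>I\<close> is an initial segment of \<open>r\<close>. Since the members of the sequence are submodels of the later
  ones, continuity is a condition on the universes only.
\<close>

definition incr_cont ::
  "('f, 'r) vocab \<Rightarrow> 'i rel \<Rightarrow> 'i set \<Rightarrow> ('i \<Rightarrow> ('f, 'r, 'a) struct) \<Rightarrow> bool" where
  "incr_cont V r I M \<longleftrightarrow>
     (\<forall>i \<in> I. is_struct V (M i)) \<and>
     (\<forall>i \<in> I. \<forall>j \<in> I. (i, j) \<in> r \<longrightarrow> elem_submodel V (M i) (M j)) \<and>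
     (\<forall>\<delta> \<in> I. is_limit r \<delta> \<longrightarrow> univ (M \<delta>) = (\<Union>i \<in> underS r \<delta>. univ (M i)))"

definition Pr_seq ::
  "('f, 'r) vocab \<Rightarrow> 'l rel \<Rightarrow> 'k rel \<Rightarrow> ('l set \<Rightarrow> ('f, 'r, 'a) struct) \<Rightarrow> bool" where
  "Pr_seq V lam \<kappa> M \<longleftrightarrow>
     incr_cont V (cardSuc lam) (Field (cardSuc lam)) M \<and>
     (\<forall>\<alpha> \<in> Field (cardSuc lam). |univ (M \<alpha>)| =o lam) \<and>
     (\<exists>E. club (cardSuc lam) E \<and>
        (\<forall>\<alpha> \<in> cof_points (cardSuc lam) lam \<inter> E.
         \<forall>\<delta>1 \<in> cof_points (cardSuc lam) \<kappa> \<inter> E.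
         \<forall>\<delta>2 \<in> cof_points (cardSuc lam) \<kappa> \<inter> E.
           \<alpha> \<in> underS (cardSuc lam) \<delta>1 \<and> \<delta>1 \<in> underS (cardSuc lam) \<delta>2 \<longrightarrow>
           \<not> (\<exists>\<pi>. automorphism V (M \<alpha>) \<pi> \<and>
                move_tp \<pi> ` realized_tps V (M \<alpha>) (M \<delta>1) = realized_tps V (M \<alpha>) (M \<delta>2))))"

text \<open>
  A strategy \<open>F\<close> receives the index \<open>i\<close> and the sequence \<open>\<langle>M\<^sub>j : j \<le> i\<rangle>\<close>, that is, the function \<open>M\<close>
  restricted to \<open>under r i\<close>.
\<close>

definition obeys :: "('f, 'r) vocab \<Rightarrow> 'i rel \<Rightarrow>
    ('i \<Rightarrow> ('i \<Rightarrow> ('f, 'r, 'a) struct) \<Rightarrow> ('f, 'r, 'a) struct) \<Rightarrow>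
    ('i \<Rightarrow> ('f, 'r, 'a) struct) \<Rightarrow> bool" where
  "obeys V r F M \<longleftrightarrow>
     (\<forall>i \<in> Field r.
        elem_submodel V (M (osuc r i)) (F (osuc r i) (restrict M (under r (osuc r i)))) \<and>
        elem_submodel V (F (osuc r i) (restrict M (under r (osuc r i)))) (M (osuc r (osuc r i))))"

definition Pr_theory ::
  "'a itself \<Rightarrow> ('f, 'r) vocab \<Rightarrow> ('f, 'r) fm set \<Rightarrow> 'l rel \<Rightarrow> 'k rel \<Rightarrow> bool" where
  "Pr_theory (_ :: 'a itself) V T lam \<kappa> \<longleftrightarrow>
     (\<exists>F :: 'l set \<Rightarrow> ('l set \<Rightarrow> ('f, 'r, 'a) struct) \<Rightarrow> ('f, 'r, 'a) struct.
        (\<forall>i \<in> Field (cardSuc lam). \<forall>M.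
           incr_cont V (cardSuc lam) (under (cardSuc lam) i) M \<and>
           (\<forall>j \<in> under (cardSuc lam) i. M j \<in> EC_card V T lam) \<longrightarrow>
           F i (restrict M (under (cardSuc lam) i)) \<in> EC_card V T lam \<and>
           elem_submodel V (M i) (F i (restrict M (under (cardSuc lam) i)))) \<and>
        (\<forall>M.
           incr_cont V (cardSuc lam) (Field (cardSuc lam)) M \<and>
           (\<forall>i \<in> Field (cardSuc lam). M i \<in> EC_card V T lam) \<and>
           obeys V (cardSuc lam) F M \<longrightarrow>
           Pr_seq V lam \<kappa> M))"

end

theory Submission
  imports Defs
begin

text \<open>
  Both hypotheses give a formula \<open>\<phi>\<close> that shatters arbitrarily large finite families of tuples.
  Let \<open>\<mu> = min(2^\<kappa>, \<lambda>)\<close> and let \<open>Z\<close> be a set of \<open>\<mu>\<close> indices of an independent family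
  \<open>A\<^sub>\<zeta> \<subseteq> K\<close> with \<open>|K| = \<kappa>\<close>. At its first move the strategy adds tuples \<open>b\<^sub>\<zeta>\<close> and \<open>c\<^sub>\<epsilon>\<close> such that
  \<open>\<phi>(c\<^sub>\<epsilon>, b\<^sub>\<zeta>)\<close> iff \<open>\<epsilon> \<in> A\<^sub>\<zeta>\<close>. For \<open>P \<prec> N\<close>, a \<open>K\<close>-sequence \<open>c\<close> and a tuple \<open>d\<close> in \<open>N\<close> code the set
  of all \<open>\<zeta> \<in> Z\<close> for which some \<open>b\<close> in \<open>P\<close> satisfies \<open>\<phi>(d, b)\<close> and has trace \<open>A\<^sub>\<zeta>\<close> over \<open>c\<close>. The family of coded
  sets depends only on the types over \<open>P\<close> realised in \<open>N\<close>, is invariant under automorphisms of \<open>P\<close>,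
  and has at most \<open>\<lambda>^\<kappa> < 2^\<mu>\<close> members. So at each stage the strategy can choose some \<open>X \<subseteq> Z\<close> that is
  not yet coded over any earlier model, and add \<open>d\<close> realising the average type of the \<open>c\<^sub>\<epsilon>\<close> along an
  ultrafilter \<open>D\<close> with \<open>A\<^sub>\<zeta> \<in> D\<close> iff \<open>\<zeta> \<in> X\<close>. An average type does not distinguish tuples with the same
  trace over \<open>c\<close>, hence \<open>c\<close> and \<open>d\<close> code exactly \<open>X\<close> over every earlier model containing the \<open>b\<^sub>\<zeta>\<close>.
\<close>

section \<open>Cardinal bounds and ultrafilters\<close>

lemma card_of_image_bound: "|A| \<le>o r \<Longrightarrow> |f ` A| \<le>o r"
  using card_of_image ordLeq_transitive by blast

lemma card_of_subset_bound: "A \<subseteq> B \<Longrightarrow> |B| \<le>o r \<Longrightarrow> |A| \<le>o r"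
  using card_of_mono1 ordLeq_transitive by blast

lemma card_of_Times_bound: "Cinfinite r \<Longrightarrow> |A| \<le>o r \<Longrightarrow> |B| \<le>o r \<Longrightarrow> |A \<times> B| \<le>o r"
  using cprod_cinfinite_bound[of "|A|" r "|B|"] by (simp add: cprod_def Field_card_of card_of_card_order_on)

lemma card_of_Plus_bound: "Cinfinite r \<Longrightarrow> |A| \<le>o r \<Longrightarrow> |B| \<le>o r \<Longrightarrow> |A <+> B| \<le>o r"
  using csum_cinfinite_bound[of "|A|" r "|B|"] by (simp add: csum_def Field_card_of card_of_card_order_on)

lemma card_of_countable_bound: "Cinfinite r \<Longrightarrow> |A :: nat set| \<le>o r"
proof -
  assume r: "Cinfinite r"
  have "|UNIV :: nat set| \<le>o r"
    using natLeq_ordLeq_cinfinite[OF r] card_of_nat ordIso_ordLeq_trans by blast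
  then show ?thesis by (rule card_of_subset_bound[rotated]) simp
qed

lemma card_of_finite_bound: "Cinfinite r \<Longrightarrow> finite A \<Longrightarrow> |A| \<le>o r"
  by (metis Cfinite_ordLess_Cinfinite Field_card_of card_of_Card_order cfinite_def ordLess_imp_ordLeq)

lemma card_of_lists_bound:
  assumes r: "Cinfinite r" and A: "|A| \<le>o r"
  shows "|lists A| \<le>o r"
proof -
  let ?L = "\<lambda>n. {xs \<in> lists A. length xs = n}"
  have "|?L n| \<le>o r" for n
  proof (induction n)
    case 0
    have "?L 0 \<subseteq> {[]}" by auto
    then have "finite (?L 0)" using finite_subset by blast
    then show ?case by (rule card_of_finite_bound[OF r])
  next
    case (Suc n)
    have "?L (Suc n) \<subseteq> (\<lambda>(x, xs). x # xs) ` (A \<times> ?L n)"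
      by (auto simp: length_Suc_conv image_iff)
    then show ?case
      using card_of_Times_bound[OF r A Suc] card_of_image_bound card_of_subset_bound by blast
  qed
  moreover have "lists A = (\<Union>n. ?L n)" by auto
  ultimately show ?thesis
    using UNION_Cinfinite_bound[of UNIV r ?L] card_of_countable_bound[OF r] r by simp
qed

text \<open>Each symbol \<open>c\<close> acts on lists of every length, so no arities are tracked.
  Terms, formulas and Skolem hulls are all counted through this closure.\<close>

inductive_set generated :: "'x set \<Rightarrow> 'c set \<Rightarrow> ('c \<Rightarrow> 'x list \<Rightarrow> 'x) \<Rightarrow> 'x set"
  for A C g where
  base: "x \<in> A \<Longrightarrow> x \<in> generated A C g"
| step: "c \<in> C \<Longrightarrow> \<forall>x \<in> set xs. x \<in> generated A C g \<Longrightarrow> g c xs \<in> generated A C g"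

text \<open>Countably many stages exhaust the closure: the finitely many arguments of an operation
  lie in a common stage, and its value in the next one.\<close>

lemma card_of_generated_bound:
  assumes r: "Cinfinite r" and A: "|A| \<le>o r" and C: "|C| \<le>o r"
  shows "|generated A C g| \<le>o r"
proof -
  define S where "S = rec_nat A (\<lambda>_ S. S \<union> (\<lambda>(c, xs). g c xs) ` (C \<times> lists S))"
  have S0: "S 0 = A" and SS: "S (Suc n) = S n \<union> (\<lambda>(c, xs). g c xs) ` (C \<times> lists (S n))" for n
    by (simp_all add: S_def)
  have "|S n| \<le>o r" for n
  proof (induction n)
    case (Suc n)
    then show ?case unfolding SS
      by (intro Un_Cinfinite_bound card_of_image_bound card_of_Times_bound card_of_lists_bound r C)
  qed (simp add: S0 A)
  then have "|\<Union>n. S n| \<le>o r"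
    using UNION_Cinfinite_bound[of UNIV r S] card_of_countable_bound[OF r] r by simp
  moreover have mono: "S m \<subseteq> S n" if "m \<le> n" for m n
    using that by (rule lift_Suc_mono_le[rotated]) (auto simp: SS)
  have "generated A C g \<subseteq> (\<Union>n. S n)"
  proof
    fix x assume "x \<in> generated A C g"
    then show "x \<in> (\<Union>n. S n)"
    proof induction
      case (base x) then show ?case using S0 by blast
    next
      case (step c xs)
      then have "\<exists>n. \<forall>x \<in> set xs. x \<in> S n"
      proof (induction xs)
        case (Cons x xs)
        then obtain n m where "\<forall>x \<in> set xs. x \<in> S n" "x \<in> S m" by auto
        then have "\<forall>y \<in> set (x # xs). y \<in> S (max n m)"
          using mono[of n "max n m"] mono[of m "max n m"] by auto
        then show ?case by blast
      qed simp
      then obtain n where "xs \<in> lists (S n)" by blast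
      then have "g c xs \<in> S (Suc n)" using step(1) unfolding SS by force
      then show ?case by blast
    qed
  qed
  ultimately show ?thesis by (rule card_of_subset_bound[rotated])
qed

section \<open>Ultrafilters in the lattice of filters\<close>

definition ultra :: "'i filter \<Rightarrow> bool" where
  "ultra U \<longleftrightarrow> U \<noteq> bot \<and> (\<forall>P. eventually P U \<or> eventually (\<lambda>i. \<not> P i) U)"

lemma ultra_not: "ultra U \<Longrightarrow> eventually (\<lambda>i. \<not> P i) U \<longleftrightarrow> \<not> eventually P U"
  unfolding ultra_def using eventually_conj[of P U "\<lambda>i. \<not> P i"] by (auto simp: trivial_limit_def)

lemma ultra_const: "ultra U \<Longrightarrow> eventually (\<lambda>i. P) U \<longleftrightarrow> P"
  unfolding ultra_def by simp

text \<open>Finer filters are smaller in the library order, so an ultrafilter refining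
  \<open>F\<close> is a minimal proper filter below \<open>F\<close>; Zorn's lemma is applied to the
  reversed order.\<close>

lemma ex_ultra:
  assumes "F \<noteq> bot"
  shows "\<exists>U \<le> F. ultra U"
proof -
  let ?A = "{G. G \<noteq> bot \<and> G \<le> F}"
  have "\<exists>U \<in> ?A. \<forall>G \<in> ?A. G \<le> U \<longrightarrow> G = U"
  proof (rule predicate_Zorn)
    show "partial_order_on ?A (relation_of (\<lambda>U G. G \<le> U) ?A)"
      by (rule partial_order_on_relation_ofI) auto
  next
    fix C assume C: "C \<in> Chains (relation_of (\<lambda>U G. G \<le> U) ?A)"
    then have CA: "C \<subseteq> ?A" and lin: "\<And>G H. G \<in> C \<Longrightarrow> H \<in> C \<Longrightarrow> G \<le> H \<or> H \<le> G"
      unfolding Chains_def relation_of_def by blast+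
    show "\<exists>u \<in> ?A. \<forall>a \<in> C. u \<le> a"
    proof (cases "C = {}")
      case True then show ?thesis using assms by auto
    next
      case False
      \<comment> \<open>A chain is directed, so an impossible event of its infimum would already be
        an event of one member.\<close>
      have "\<not> eventually (\<lambda>_. False) (Inf C)"
      proof
        assume "eventually (\<lambda>_. False) (Inf C)"
        moreover have "\<exists>x \<in> C. x \<le> inf G H" if "G \<in> C" "H \<in> C" for G H
          using lin[OF that] that by (metis inf.absorb1 inf.absorb2 order_refl)
        ultimately obtain G where "G \<in> C" "eventually (\<lambda>_. False) G"
          using eventually_Inf_base[OF False] by blast
        then show False using CA by (auto simp: trivial_limit_def)
      qed
      then have "Inf C \<noteq> bot" by (simp add: trivial_limit_def)
      moreover obtain G where "G \<in> C" using False by blast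
      then have "Inf C \<le> F" using CA by (intro Inf_lower2[of G]) auto
      ultimately show ?thesis by (auto intro!: Inf_lower)
    qed
  qed
  then obtain U where U: "U \<noteq> bot" "U \<le> F" and max: "\<And>G. G \<noteq> bot \<Longrightarrow> G \<le> F \<Longrightarrow> G \<le> U \<Longrightarrow> G = U"
    by blast
  \<comment> \<open>If the complement of \<open>P\<close> is not in \<open>U\<close>, adding
    \<open>P\<close> keeps the filter proper, and by minimality \<open>P\<close> was there
    already.\<close>
  have "eventually P U \<or> eventually (\<lambda>i. \<not> P i) U" for P
  proof (rule disjCI)
    assume "\<not> eventually (\<lambda>i. \<not> P i) U"
    then have "inf U (principal {i. P i}) \<noteq> bot"
      by (simp add: trivial_limit_def eventually_inf_principal)
    then have "inf U (principal {i. P i}) = U"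
      using max U by (meson inf.cobounded1 order_trans)
    then have "U \<le> principal {i. P i}" by (metis inf.cobounded2)
    then show "eventually P U" by (simp add: le_principal)
  qed
  then show ?thesis using U unfolding ultra_def by blast
qed

section \<open>Syntax\<close>

lemma val_cong: "(\<And>n. n \<in> fv_tm t \<Longrightarrow> e n = e' n) \<Longrightarrow> val M e t = val M e' t"
proof (induction t)
  case (App f ts)
  then have "map (val M e) ts = map (val M e') ts" by auto
  then show ?case by (simp only: val.simps)
qed simp

lemma sat_cong: "(\<And>n. n \<in> fv p \<Longrightarrow> e n = e' n) \<Longrightarrow> sat M e p \<longleftrightarrow> sat M e' p"
proof (induction p arbitrary: e e')
  case (Eq s t)
  then show ?case using val_cong[of s e e' M] val_cong[of t e e' M] by auto
next
  case (Rel R ts)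
  then have "map (val M e) ts = map (val M e') ts" by (auto intro!: val_cong)
  then show ?case by (simp only: sat.simps)
next
  case (Neg p)
  have "sat M e p \<longleftrightarrow> sat M e' p" by (rule Neg.IH) (use Neg.prems in simp)
  then show ?case by simp
next
  case (Con p q)
  have "sat M e p \<longleftrightarrow> sat M e' p" "sat M e q \<longleftrightarrow> sat M e' q"
    by (rule Con.IH; use Con.prems in simp)+
  then show ?case by simp
next
  case (Ex n p)
  have "sat M (e(n := a)) p \<longleftrightarrow> sat M (e'(n := a)) p" for a
    by (rule Ex.IH) (use Ex.prems in auto)
  then show ?case by simp
qed

text \<open>Values of \<open>(!) as\<close> beyond the length of \<open>as\<close> are unspecified.
  A formula with its variables below that length does not see them, so any assignment extending the
  list may be used.\<close>

lemma holds_eq_sat: "p \<in> formulas V (length as) \<Longrightarrow> (\<And>i. i < length as \<Longrightarrow> e i = as ! i) \<Longrightarrow>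
    holds M p as \<longleftrightarrow> sat M e p"
  unfolding holds_def formulas_def by (auto intro!: sat_cong)

lemma finite_fv_tm [simp]: "finite (fv_tm t)" by (induction t) auto

lemma finite_fv [simp]: "finite (fv p)" by (induction p) auto

lemma val_interp_cong:
  "(\<And>f. f \<in> set_tm t \<Longrightarrow> fint M f = fint N f) \<Longrightarrow> val M e t = val N e t"
proof (induction t)
  case (App f ts)
  have "map (val M e) ts = map (val N e) ts" using App by auto
  then show ?case using App.prems by (simp del: map_eq_conv)
qed simp

text \<open>\<open>set1_fm\<close> and \<open>set2_fm\<close> collect the function and relation
  symbols occurring in a formula; this is what permits reinterpreting the symbols that
  \<open>T\<close> does not mention.\<close>

lemma sat_interp_cong:
  assumes "univ M = univ N"
  shows "(\<And>f. f \<in> set1_fm p \<Longrightarrow> fint M f = fint N f) \<Longrightarrow> (\<And>R. R \<in> set2_fm p \<Longrightarrow> rint M R = rint N R) \<Longrightarrow>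
    sat M e p \<longleftrightarrow> sat N e p"
proof (induction p arbitrary: e)
  case (Eq s t)
  then show ?case using val_interp_cong[of s M N e] val_interp_cong[of t M N e] by auto
next
  case (Rel R ts)
  have "map (val M e) ts = map (val N e) ts" using Rel by (auto intro!: val_interp_cong)
  then show ?case using Rel by (simp del: map_eq_conv)
qed (auto simp: assms)

lemma finite_set_tm [simp]: "finite (set_tm t)" by (induction t) auto

lemma finite_set1_fm [simp]: "finite (set1_fm p)" by (induction p) auto

lemma finite_set2_fm [simp]: "finite (set2_fm p)" by (induction p) auto

section \<open>Counting terms and formulas\<close>

lemma card_of_terms_bound:
  fixes V :: "('f, 'r) vocab"
  assumes r: "Cinfinite r" and F: "|fsyms V| \<le>o r"
  shows "|{t. tm_over V t}| \<le>o r"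
proof -
  \<comment> \<open>\<open>Inl n\<close> ignores its argument list, so a variable counts as a
    nullary operation.\<close>
  define g :: "nat + 'f \<Rightarrow> 'f tm list \<Rightarrow> 'f tm"
    where "g = (\<lambda>c ts. case c of Inl n \<Rightarrow> Var n | Inr f \<Rightarrow> App f ts)"
  let ?C = "UNIV <+> fsyms V"
  have "t \<in> generated {} ?C g" if "tm_over V t" for t
    using that
  proof (induction t)
    case (Var n)
    show ?case using generated.step[of "Inl n" ?C "[]" "{}" g] by (auto simp: g_def)
  next
    case (App f ts)
    then show ?case using generated.step[of "Inr f" ?C ts "{}" g] by (auto simp: g_def list_all_iff)
  qed
  then have sub: "{t. tm_over V t} \<subseteq> generated {} ?C g" by blast
  have "|generated {} ?C g| \<le>o r"
    by (intro card_of_generated_bound r card_of_Plus_bound card_of_countable_bound F card_of_finite_bound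
        finite.emptyI)
  then show ?thesis by (rule card_of_subset_bound[OF sub])
qed

lemma card_of_formulas_bound:
  fixes V :: "('f, 'r) vocab"
  assumes r: "Cinfinite r" and F: "|fsyms V| \<le>o r" and R: "|rsyms V| \<le>o r"
  shows "|{p. fm_over V p}| \<le>o r"
proof -
  \<comment> \<open>Symbol 0 negates, 1 conjoins and \<open>n + 2\<close> quantifies the variable
    \<open>n\<close>. Argument lists of other lengths yield junk, harmless for an upper
    bound.\<close>
  define g :: "nat \<Rightarrow> ('f, 'r) fm list \<Rightarrow> ('f, 'r) fm"
    where "g = (\<lambda>c ps. case c of 0 \<Rightarrow> Neg (ps ! 0) | Suc 0 \<Rightarrow> Con (ps ! 0) (ps ! 1)
      | Suc (Suc n) \<Rightarrow> Ex n (ps ! 0))"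
  let ?T = "{t. tm_over V t}"
  let ?A = "(\<lambda>(s, t). Eq s t) ` (?T \<times> ?T) \<union> (\<lambda>(R, ts). Rel R ts) ` (rsyms V \<times> lists ?T)"
  let ?G = "generated ?A UNIV g"
  have "p \<in> ?G" if "fm_over V p" for p
    using that
  proof (induction p)
    case (Eq s t)
    then show ?case by (intro generated.base) auto
  next
    case (Rel R ts)
    then show ?case by (intro generated.base) (auto simp: list_all_iff image_iff)
  next
    case (Neg p)
    then show ?case using generated.step[of 0 UNIV "[p]" ?A g] by (simp add: g_def)
  next
    case (Con p q)
    then show ?case using generated.step[of "Suc 0" UNIV "[p, q]" ?A g] by (simp add: g_def)
  next
    case (Ex n p)
    then show ?case using generated.step[of "Suc (Suc n)" UNIV "[p]" ?A g] by (simp add: g_def)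
  qed
  then have sub: "{p. fm_over V p} \<subseteq> ?G" by blast
  have "|?G| \<le>o r"
    by (intro card_of_generated_bound r Un_Cinfinite_bound card_of_image_bound card_of_Times_bound
        card_of_lists_bound card_of_terms_bound card_of_countable_bound F R)
  then show ?thesis by (rule card_of_subset_bound[OF sub])
qed

section \<open>The vocabulary of a complete theory\<close>

lemma EC_reinterpret:
  assumes M: "M \<in> EC V T" and univ: "univ N = univ M"
    and f: "\<And>f. f \<in> \<Union> (set1_fm ` T) \<Longrightarrow> fint N f = fint M f"
    and R: "\<And>R. R \<in> \<Union> (set2_fm ` T) \<Longrightarrow> rint N R = rint M R"
    and str: "is_struct V N"
  shows "N \<in> EC V T"
proof -
  have "holds N p []" if "p \<in> T" for p
  proof -
    have "holds M p []" using M that by (simp add: EC_def)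
    moreover have "sat N ((!) []) p \<longleftrightarrow> sat M ((!) []) p"
      by (rule sat_interp_cong) (use univ f R that in blast)+
    ultimately show ?thesis by (simp add: holds_def)
  qed
  then show ?thesis using str by (simp add: EC_def)
qed

lemma complete_theory_agree:
  fixes M N :: "('f, 'r, 'a) struct"
  assumes "complete_theory TYPE('a) V T" "M \<in> EC V T" "N \<in> EC V T" "p \<in> sentences V"
  shows "holds M p [] \<longleftrightarrow> holds N p []"
proof -
  have "(\<forall>M \<in> (EC V T :: ('f, 'r, 'a) struct set). holds M p []) \<or>
        (\<forall>M \<in> (EC V T :: ('f, 'r, 'a) struct set). holds M (Neg p) [])"
    using assms(1,4) by (simp add: complete_theory_def)
  then show ?thesis using assms(2,3) by (auto simp: holds_def)
qed

text \<open>An unmentioned relation symbol could be made always true or always false, and the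
  sentence saying that it holds at some constant tuple would be undecided.\<close>

lemma rsyms_complete_theory:
  fixes M :: "('f, 'r, 'a) struct"
  assumes compl: "complete_theory TYPE('a) V T" and M: "M \<in> EC V T"
  shows "rsyms V \<subseteq> \<Union> (set2_fm ` T)"
proof (rule ccontr)
  assume "\<not> ?thesis"
  then obtain R where R: "R \<in> rsyms V" "R \<notin> \<Union> (set2_fm ` T)" by blast
  define N where "N b = M\<lparr>rint := (rint M)(R := \<lambda>_. b)\<rparr>" for b
  have N: "N b \<in> EC V T" for b
    by (rule EC_reinterpret[OF M]) (use R M in \<open>auto simp: N_def EC_def is_struct_def\<close>)
  define p where "p = (Ex 0 (Rel R (replicate (rar V R) (Var 0))) :: ('f, 'r) fm)"
  have "p \<in> sentences V" using R by (auto simp: p_def formulas_def list_all_iff)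
  from complete_theory_agree[OF compl N[of True] N[of False] this]
  have "univ M = {}" by (simp add: holds_def p_def N_def)
  then show False using M by (simp add: EC_def is_struct_def)
qed

text \<open>An unmentioned function symbol of positive arity may or may not have a fixed point on
  the diagonal, and two unmentioned constants may or may not be equal; both contradict completeness.
  A single unmentioned constant can remain.\<close>

lemma fsyms_complete_theory:
  fixes M :: "('f, 'r, 'a) struct"
  assumes compl: "complete_theory TYPE('a) V T" and M: "M \<in> EC V T" and inf: "infinite (univ M)"
  shows "\<exists>c. fsyms V \<subseteq> insert c (\<Union> (set1_fm ` T))"
proof -
  let ?S = "\<Union> (set1_fm ` T)"
  obtain a where a: "a \<in> univ M" using inf by fastforce
  obtain b where b: "b \<in> univ M" "a \<noteq> b"
    using inf by (metis finite.emptyI finite_insert infinite_super insertCI subsetI)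
  have str: "is_struct V M" using M by (simp add: EC_def)
  have ar: "far V f = 0" if f: "f \<in> fsyms V" "f \<notin> ?S" for f
  proof (rule ccontr)
    assume n: "far V f \<noteq> 0"
    define N where "N h = M\<lparr>fint := (fint M)(f := \<lambda>xs. h (hd xs))\<rparr>" for h
    have N: "N h \<in> EC V T" if "\<And>x. x \<in> univ M \<Longrightarrow> h x \<in> univ M" for h
    proof (rule EC_reinterpret[OF M])
      have "h (hd xs) \<in> univ M" if "xs \<in> lists (univ M)" "length xs = far V f" for xs
        using that n \<open>\<And>x. x \<in> univ M \<Longrightarrow> h x \<in> univ M\<close> by (cases xs) auto
      then show "is_struct V (N h)" using str by (auto simp: N_def is_struct_def)
    qed (use f in \<open>auto simp: N_def\<close>)
    \<comment> \<open>\<open>h\<close> has no fixed point because \<open>a \<noteq> b\<close>, in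
      contrast to the identity.\<close>
    define h where "h x = (if x = a then b else a)" for x
    define p where "p = (Ex 0 (Eq (App f (replicate (far V f) (Var 0))) (Var 0)) :: ('f, 'r) fm)"
    have p: "p \<in> sentences V" using f by (auto simp: p_def formulas_def list_all_iff)
    have "holds (N (\<lambda>x. x)) p []" using a n by (auto simp: holds_def p_def N_def)
    moreover have "\<not> holds (N h) p []" using n b by (auto simp: holds_def p_def N_def h_def)
    moreover have "N h \<in> EC V T" "N (\<lambda>x. x) \<in> EC V T" using a b by (auto intro!: N simp: h_def)
    ultimately show False using complete_theory_agree[OF compl _ _ p] by blast
  qed
  have uniq: "c = d" if c: "c \<in> fsyms V" "c \<notin> ?S" and d: "d \<in> fsyms V" "d \<notin> ?S" for c d
  proof (rule ccontr)
    assume ne: "c \<noteq> d"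
    define N where "N x = M\<lparr>fint := (fint M)(c := \<lambda>_. a, d := \<lambda>_. x)\<rparr>" for x
    have N: "N x \<in> EC V T" if "x \<in> univ M" for x
      by (rule EC_reinterpret[OF M]) (use c d a that str in \<open>auto simp: N_def is_struct_def\<close>)
    define p where "p = (Eq (App c []) (App d []) :: ('f, 'r) fm)"
    have p: "p \<in> sentences V" using c d ar by (auto simp: p_def formulas_def)
    have "holds (N a) p []" "\<not> holds (N b) p []" using ne b by (auto simp: holds_def p_def N_def)
    then show False using complete_theory_agree[OF compl N N p] a b by blast
  qed
  show ?thesis
  proof (cases "fsyms V \<subseteq> ?S")
    case False
    then show ?thesis using uniq by blast
  qed blast
qed

text \<open>Completeness forces \<open>T\<close> to mention all symbols of the vocabulary except possibly one constant,
  so the bound on \<open>|T|\<close> bounds the vocabulary.\<close>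

lemma card_of_vocab_bound:
  fixes M :: "('f, 'r, 'a) struct"
  assumes compl: "complete_theory TYPE('a) V T" and M: "M \<in> EC V T" and inf: "infinite (univ M)"
    and r: "Cinfinite r" and T: "|T| \<le>o r"
  shows "|fsyms V| \<le>o r" "|rsyms V| \<le>o r"
proof -
  have 1: "|\<Union> (set1_fm ` T)| \<le>o r" "|\<Union> (set2_fm ` T)| \<le>o r"
    by (rule UNION_Cinfinite_bound[OF T _ r], simp add: card_of_finite_bound[OF r])+
  obtain c where "fsyms V \<subseteq> {c} \<union> \<Union> (set1_fm ` T)"
    using fsyms_complete_theory[OF compl M inf] by auto
  then show "|fsyms V| \<le>o r"
    by (rule card_of_subset_bound) (intro Un_Cinfinite_bound card_of_finite_bound r 1 finite.intros)
  show "|rsyms V| \<le>o r"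
    using rsyms_complete_theory[OF compl M] 1(2) by (rule card_of_subset_bound)
qed

section \<open>Reduced Skolem ultrapowers\<close>

text \<open>A Skolem function for \<open>Ex n p\<close> that reads variable \<open>j\<close> from
  \<open>xs ! j\<close> and overwrites variable \<open>n\<close>. Without a witness it returns some
  element of the universe, so that its values never leave \<open>M\<close>.\<close>

definition sk :: "('f, 'r, 'a) struct \<Rightarrow> ('f, 'r) fm \<Rightarrow> nat \<Rightarrow> 'a list \<Rightarrow> 'a" where
  "sk M p n xs = (if \<exists>a \<in> univ M. sat M (((!) xs)(n := a)) p
     then SOME a. a \<in> univ M \<and> sat M (((!) xs)(n := a)) p else SOME a. a \<in> univ M)"

lemma sk_in_univ: "is_struct V M \<Longrightarrow> sk M p n xs \<in> univ M"
proof -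
  assume "is_struct V M"
  then have "\<exists>a. a \<in> univ M" by (auto simp: is_struct_def)
  then have "(SOME a. a \<in> univ M) \<in> univ M" by (rule someI_ex)
  moreover have "(SOME a. a \<in> univ M \<and> sat M (((!) xs)(n := a)) p) \<in> univ M"
    if "\<exists>a \<in> univ M. sat M (((!) xs)(n := a)) p"
    using someI_ex[of "\<lambda>a. a \<in> univ M \<and> sat M (((!) xs)(n := a)) p"] that by blast
  ultimately show ?thesis by (auto simp: sk_def)
qed

lemma sat_sk:
  assumes a: "a \<in> univ M" "sat M (e(n := a)) p" and xs: "\<And>j. j \<in> fv p \<Longrightarrow> j \<noteq> n \<Longrightarrow> xs ! j = e j"
  shows "sat M (e(n := sk M p n xs)) p"
proof -
  have eq: "sat M (((!) xs)(n := x)) p \<longleftrightarrow> sat M (e(n := x)) p" for x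
    by (rule sat_cong) (use xs in auto)
  then have ex: "\<exists>a. a \<in> univ M \<and> sat M (((!) xs)(n := a)) p" using a by blast
  then have "sat M (((!) xs)(n := sk M p n xs)) p"
    using someI_ex[OF ex] by (auto simp: sk_def)
  then show ?thesis by (simp add: eq)
qed

text \<open>\<open>N\<close> is a reduced form of the ultrapower of \<open>M\<close>: only the
  functions in \<open>H\<close> are used, and \<open>r\<close> names their classes modulo
  \<open>U\<close>. Closure of \<open>H\<close> under Skolem functions replaces fullness of the
  ultrapower and leaves room for a small \<open>H\<close>.\<close>

context
  fixes V :: "('f, 'r) vocab" and M N :: "('f, 'r, 'a) struct" and U :: "'i filter"
    and H :: "('i \<Rightarrow> 'a) set" and r :: "('i \<Rightarrow> 'a) \<Rightarrow> 'a"
  assumes ultra: "ultra U"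
    and HM: "\<And>g i. g \<in> H \<Longrightarrow> g i \<in> univ M"
    and skH: "\<And>p n gs. fm_over V p \<Longrightarrow> gs \<in> lists H \<Longrightarrow> (\<lambda>i. sk M p n (map (\<lambda>g. g i) gs)) \<in> H"
    and fnH: "\<And>f gs. f \<in> fsyms V \<Longrightarrow> gs \<in> lists H \<Longrightarrow> length gs = far V f \<Longrightarrow>
      (\<lambda>i. fint M f (map (\<lambda>g. g i) gs)) \<in> H"
    and r: "\<And>f g. f \<in> H \<Longrightarrow> g \<in> H \<Longrightarrow> r f = r g \<longleftrightarrow> eventually (\<lambda>i. f i = g i) U"
    and univN: "univ N = r ` H"
    and fintN: "\<And>f gs. f \<in> fsyms V \<Longrightarrow> gs \<in> lists H \<Longrightarrow> length gs = far V f \<Longrightarrow>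
      fint N f (map r gs) = r (\<lambda>i. fint M f (map (\<lambda>g. g i) gs))"
    and rintN: "\<And>R gs. gs \<in> lists H \<Longrightarrow>
      rint N R (map r gs) \<longleftrightarrow> eventually (\<lambda>i. rint M R (map (\<lambda>g. g i) gs)) U"
begin

lemma Los_val:
  assumes e: "\<And>n. e n \<in> H"
  shows "tm_over V t \<Longrightarrow> (\<lambda>i. val M (\<lambda>n. e n i) t) \<in> H \<and>
    val N (\<lambda>n. r (e n)) t = r (\<lambda>i. val M (\<lambda>n. e n i) t)"
proof (induction t)
  case (Var n)
  then show ?case using e by simp
next
  case (App f ts)
  define gs where "gs = map (\<lambda>t i. val M (\<lambda>n. e n i) t) ts"
  have gs: "gs \<in> lists H" "map (val N (\<lambda>n. r (e n))) ts = map r gs"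
    using App by (auto simp: gs_def list_all_iff)
  have eq: "map (val M (\<lambda>n. e n i)) ts = map (\<lambda>g. g i) gs" for i by (simp add: gs_def)
  have f: "f \<in> fsyms V" "length gs = far V f" using App.prems by (auto simp: gs_def)
  show ?case
    unfolding val.simps gs(2) eq using fnH[OF f(1) gs(1) f(2)] fintN[OF f(1) gs(1) f(2)] by simp
qed

text \<open>The theorem of Los. Only the existential case needs more than the filter laws: the
  witnesses for different indices are chosen by one Skolem function, hence form a member of
  \<open>H\<close>.\<close>

lemma Los_sat:
  "fm_over V p \<Longrightarrow> (\<And>n. e n \<in> H) \<Longrightarrow>
    sat N (\<lambda>n. r (e n)) p \<longleftrightarrow> eventually (\<lambda>i. sat M (\<lambda>n. e n i) p) U"
proof (induction p arbitrary: e)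
  case (Eq s t)
  then show ?case using Los_val[of e s] Los_val[of e t] r by auto
next
  case (Rel R ts)
  define gs where "gs = map (\<lambda>t i. val M (\<lambda>n. e n i) t) ts"
  have gs: "gs \<in> lists H" "map (val N (\<lambda>n. r (e n))) ts = map r gs"
    using Rel Los_val[of e] by (auto simp: gs_def list_all_iff)
  have eq: "map (val M (\<lambda>n. e n i)) ts = map (\<lambda>g. g i) gs" for i by (simp add: gs_def)
  show ?case unfolding sat.simps gs(2) eq by (rule rintN[OF gs(1)])
next
  case (Neg p)
  then show ?case by (simp add: ultra_not[OF ultra])
next
  case (Con p q)
  then show ?case by (simp add: eventually_conj_iff)
next
  case (Ex n p)
  have IH: "sat N ((\<lambda>m. r (e m))(n := r g)) p \<longleftrightarrow>
      eventually (\<lambda>i. sat M ((\<lambda>m. e m i)(n := g i)) p) U" if "g \<in> H" for g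
  proof -
    have "(\<lambda>m. r ((e(n := g)) m)) = (\<lambda>m. r (e m))(n := r g)"
      and "(\<lambda>m. (e(n := g)) m i) = (\<lambda>m. e m i)(n := g i)" for i by auto
    then show ?thesis using Ex.IH[of "e(n := g)"] Ex.prems that by simp
  qed
  show ?case
  proof
    assume "sat N (\<lambda>n. r (e n)) (Ex n p)"
    then obtain g where g: "g \<in> H" "sat N ((\<lambda>m. r (e m))(n := r g)) p" using univN by auto
    then have "eventually (\<lambda>i. sat M ((\<lambda>m. e m i)(n := g i)) p) U" using IH by blast
    then show "eventually (\<lambda>i. sat M (\<lambda>n. e n i) (Ex n p)) U"
      by (rule eventually_mono) (use HM g(1) in auto)
  next
    assume ev: "eventually (\<lambda>i. sat M (\<lambda>n. e n i) (Ex n p)) U"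
    \<comment> \<open>\<open>L\<close> bounds the free variables of \<open>p\<close>, so the first
      \<open>L\<close> values of the assignment determine the Skolem witness.\<close>
    obtain L where L: "\<And>j. j \<in> fv p \<Longrightarrow> j < L"
      using finite_fv[of p] unfolding finite_nat_set_iff_bounded by auto
    define g where "g = (\<lambda>i. sk M p n (map (\<lambda>g. g i) (map e [0..<L])))"
    have g: "g \<in> H" unfolding g_def using Ex.prems by (intro skH) auto
    have "sat M ((\<lambda>m. e m i)(n := g i)) p" if "sat M (\<lambda>n. e n i) (Ex n p)" for i
    proof -
      from that obtain a where "a \<in> univ M" "sat M ((\<lambda>m. e m i)(n := a)) p" by auto
      then show ?thesis unfolding g_def by (rule sat_sk) (use L in auto)
    qed
    then have "eventually (\<lambda>i. sat M ((\<lambda>m. e m i)(n := g i)) p) U"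
      using ev by (rule eventually_mono[rotated])
    then show "sat N (\<lambda>n. r (e n)) (Ex n p)" using IH[OF g] univN g by auto
  qed
qed

lemma Los_holds:
  assumes gs: "gs \<in> lists H" and p: "p \<in> formulas V (length gs)" and ne: "H \<noteq> {}"
  shows "holds N p (map r gs) \<longleftrightarrow> eventually (\<lambda>i. holds M p (map (\<lambda>g. g i) gs)) U"
proof -
  \<comment> \<open>\<open>d\<close> fills the positions beyond the list, keeping the whole
    assignment inside \<open>H\<close>.\<close>
  obtain d where d: "d \<in> H" using ne by blast
  define e where "e n = (if n < length gs then gs ! n else d)" for n
  have e: "e n \<in> H" for n using gs d by (auto simp: e_def in_listsD)
  have "holds N p (map r gs) \<longleftrightarrow> sat N (\<lambda>n. r (e n)) p"
    by (rule holds_eq_sat[of _ V]) (use p in \<open>auto simp: e_def\<close>)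
  moreover have "holds M p (map (\<lambda>g. g i) gs) \<longleftrightarrow> sat M (\<lambda>n. e n i) p" for i
    by (rule holds_eq_sat[of _ V]) (use p in \<open>auto simp: e_def\<close>)
  moreover have "fm_over V p" using p by (simp add: formulas_def)
  ultimately show ?thesis using Los_sat e by simp
qed

end

text \<open>Classes are named by elements of \<open>'a\<close>, the class of the constant
  \<open>k a\<close> by \<open>a\<close> itself, so that \<open>M\<close> becomes literally a subset
  of the new model. There is room for the other classes because the complement of \<open>A\<close>
  has more than \<open>lam\<close> elements.\<close>

lemma ex_representatives:
  fixes A :: "'a set" and H :: "'h set" and k :: "'a \<Rightarrow> 'h"
  assumes lam: "Cinfinite lam" and big: "cardSuc lam \<le>o |UNIV :: 'a set|"
    and A: "|A| \<le>o lam" and H: "|H| \<le>o lam"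
    and equiv: "\<And>f. E f f" "\<And>f g. E f g \<Longrightarrow> E g f" "\<And>f g h. E f g \<Longrightarrow> E g h \<Longrightarrow> E f h"
    and k: "\<And>a b. a \<in> A \<Longrightarrow> b \<in> A \<Longrightarrow> E (k a) (k b) \<Longrightarrow> a = b"
  shows "\<exists>r. (\<forall>f \<in> H. \<forall>g \<in> H. r f = r g \<longleftrightarrow> E f g) \<and> (\<forall>a \<in> A. r (k a) = a)"
proof -
  have "|H| \<le>o |- A|"
  proof (rule ccontr)
    assume "\<not> |H| \<le>o |- A|"
    then have "|- A| \<le>o lam"
      using H by (meson card_of_Well_order not_ordLeq_iff_ordLess ordLess_imp_ordLeq ordLeq_transitive)
    then have "|A \<union> - A| \<le>o lam" using A lam by (intro Un_Cinfinite_bound)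
    then have "cardSuc lam \<le>o lam" using big ordLeq_transitive by (metis Compl_partition)
    then show False using lam cardSuc_greater not_ordLess_ordLeq by blast
  qed
  then obtain j where j: "inj_on j H" "j ` H \<subseteq> - A" using card_of_ordLeq by metis
  \<comment> \<open>\<open>c\<close> selects one member of each class. A class meeting no constant
    gets the fresh name that \<open>j\<close> assigns to this member.\<close>
  define c where "c f = (SOME g. g \<in> H \<and> E f g)" for f
  define r where "r f = (if \<exists>a \<in> A. E f (k a) then THE a. a \<in> A \<and> E f (k a) else j (c f))" for f
  have rA: "r f = a" if "a \<in> A" "E f (k a)" for f a
  proof -
    have "(THE a. a \<in> A \<and> E f (k a)) = a"
      by (rule the_equality) (use that k equiv in blast)+
    then show ?thesis using that by (auto simp: r_def)
  qed
  have c: "c f \<in> H" "E f (c f)" if "f \<in> H" for f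
    using someI_ex[of "\<lambda>g. g \<in> H \<and> E f g"] equiv(1) that by (auto simp: c_def)
  have c_cong: "c f = c g" if "E f g" for f g
  proof -
    have "(\<lambda>h. h \<in> H \<and> E f h) = (\<lambda>h. h \<in> H \<and> E g h)" using that equiv(2,3) by blast
    then show ?thesis by (simp add: c_def)
  qed
  have "r f = r g \<longleftrightarrow> E f g" if fg: "f \<in> H" "g \<in> H" for f g
  proof
    assume E: "E f g"
    show "r f = r g"
    proof (cases "\<exists>a \<in> A. E f (k a)")
      case True
      then obtain a where "a \<in> A" "E f (k a)" by blast
      moreover from this have "E g (k a)" using E equiv(2,3) by blast
      ultimately show ?thesis using rA by simp
    next
      case False
      then have "\<not> (\<exists>a \<in> A. E g (k a))" using E equiv(2,3) by blast
      then show ?thesis using False c_cong[OF E] unfolding r_def by presburger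
    qed
  next
    assume eq: "r f = r g"
    have out: "r h \<notin> A" "r h = j (c h)" if "h \<in> H" "\<not> (\<exists>a \<in> A. E h (k a))" for h
    proof -
      show "r h = j (c h)" using that(2) unfolding r_def by presburger
      then show "r h \<notin> A" using j c(1)[OF that(1)] by auto
    qed
    have inn: "r h \<in> A" "E h (k (r h))" if "\<exists>a \<in> A. E h (k a)" for h using that rA by auto
    show "E f g"
    proof (cases "\<exists>a \<in> A. E f (k a)")
      case True
      then have "\<exists>a \<in> A. E g (k a)" using inn out(1) fg eq by metis
      then show ?thesis using inn(2) True eq equiv(2,3) by metis
    next
      case False
      then have F: "\<not> (\<exists>a \<in> A. E g (k a))" using inn out(1) fg eq by metis
      have "j (c f) = j (c g)" using out(2)[OF fg(1) False] out(2)[OF fg(2) F] eq by simp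
      then have "c f = c g" using j c(1) fg by (meson inj_onD)
      then show ?thesis using c(2) fg equiv(2,3) by metis
    qed
  qed
  moreover have "r (k a) = a" if "a \<in> A" for a using rA that equiv(1) by blast
  ultimately show ?thesis by blast
qed

lemma eventually_eq_equiv:
  fixes U :: "'i filter" and f g h :: "'i \<Rightarrow> 'b"
  shows "eventually (\<lambda>i. f i = f i) U"
    and "eventually (\<lambda>i. f i = g i) U \<Longrightarrow> eventually (\<lambda>i. g i = f i) U"
    and "eventually (\<lambda>i. f i = g i) U \<Longrightarrow> eventually (\<lambda>i. g i = h i) U \<Longrightarrow> eventually (\<lambda>i. f i = h i) U"
  by simp (auto elim: eventually_mono eventually_elim2)

lemma skolem_hull:
  fixes M :: "('f, 'r, 'a) struct" and G :: "('i \<Rightarrow> 'a) set"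
  assumes lam: "Cinfinite lam" and str: "is_struct V M"
    and Fb: "|fsyms V| \<le>o lam" and Rb: "|rsyms V| \<le>o lam"
    and G: "|G| \<le>o lam" "\<forall>g \<in> G. \<forall>i. g i \<in> univ M"
  shows "\<exists>H. G \<subseteq> H \<and> |H| \<le>o lam \<and> (\<forall>g \<in> H. \<forall>i. g i \<in> univ M) \<and>
    (\<forall>p n gs. fm_over V p \<longrightarrow> gs \<in> lists H \<longrightarrow> (\<lambda>i. sk M p n (map (\<lambda>g. g i) gs)) \<in> H) \<and>
    (\<forall>f \<in> fsyms V. \<forall>gs \<in> lists H. length gs = far V f \<longrightarrow> (\<lambda>i. fint M f (map (\<lambda>g. g i) gs)) \<in> H)"
proof -
  obtain d where d: "d \<in> univ M" using str by (auto simp: is_struct_def)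
  \<comment> \<open>The operations act pointwise on functions of the index. \<open>d\<close> is the
    value at argument lists of the wrong length, which \<open>generated\<close> admits.\<close>
  define opn :: "'f + (('f, 'r) fm \<times> nat) \<Rightarrow> ('i \<Rightarrow> 'a) list \<Rightarrow> 'i \<Rightarrow> 'a"
    where "opn = (\<lambda>c gs i. case c of
      Inl f \<Rightarrow> if length gs = far V f then fint M f (map (\<lambda>g. g i) gs) else d
    | Inr (p, n) \<Rightarrow> sk M p n (map (\<lambda>g. g i) gs))"
  define C where "C = fsyms V <+> ({p. fm_over V p} \<times> (UNIV :: nat set))"
  define H where "H = generated G C opn"
  have step: "opn c gs \<in> H" if "c \<in> C" "gs \<in> lists H" for c gs
    using generated.step[of c C gs G opn] that unfolding H_def by auto
  have 1: "G \<subseteq> H" unfolding H_def by (auto intro: generated.base)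
  have 2: "|H| \<le>o lam" unfolding H_def C_def
    by (intro card_of_generated_bound lam G(1) card_of_Plus_bound Fb card_of_Times_bound
        card_of_formulas_bound Rb card_of_countable_bound)
  have "\<forall>i. g i \<in> univ M" if "g \<in> H" for g
    using that unfolding H_def
  proof induction
    case (base g) then show ?case using G(2) by blast
  next
    case (step c gs)
    then have "map (\<lambda>g. g i) gs \<in> lists (univ M)" for i by auto
    then have "length gs = far V f \<Longrightarrow> f \<in> fsyms V \<Longrightarrow> fint M f (map (\<lambda>g. g i) gs) \<in> univ M" for f i
      using str unfolding is_struct_def by (metis length_map)
    then show ?case using step(1) d by (auto simp: opn_def C_def sk_in_univ[OF str])
  qed
  then have 3: "\<forall>g \<in> H. \<forall>i. g i \<in> univ M" by blast
  have 4: "\<forall>p n gs. fm_over V p \<longrightarrow> gs \<in> lists H \<longrightarrow> (\<lambda>i. sk M p n (map (\<lambda>g. g i) gs)) \<in> H"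
  proof (intro allI impI)
    fix p n gs assume "fm_over V p" "gs \<in> lists H"
    then show "(\<lambda>i. sk M p n (map (\<lambda>g. g i) gs)) \<in> H"
      using step[of "Inr (p, n)" gs] by (auto simp: C_def opn_def)
  qed
  have 5: "\<forall>f \<in> fsyms V. \<forall>gs \<in> lists H. length gs = far V f \<longrightarrow>
      (\<lambda>i. fint M f (map (\<lambda>g. g i) gs)) \<in> H"
  proof (intro ballI impI)
    fix f gs assume "f \<in> fsyms V" "gs \<in> lists H" "length gs = far V f"
    then show "(\<lambda>i. fint M f (map (\<lambda>g. g i) gs)) \<in> H"
      using step[of "Inl f" gs] by (auto simp: C_def opn_def)
  qed
  show ?thesis by (intro exI[of _ H] conjI) (fact 1 2 3 4 5)+
qed

lemma lists_nth: "xs \<in> lists A \<Longrightarrow> i < length xs \<Longrightarrow> xs ! i \<in> A"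
  by (auto simp: in_lists_conv_set)

lemma lists_imageE:
  assumes "xs \<in> lists (f ` A)"
  obtains ys where "ys \<in> lists A" "xs = map f ys"
  using assms by (auto simp: lists_image)

text \<open>The prescribed functions \<open>G\<close> and the constants are closed to a Skolem hull
  of size at most \<open>lam\<close>, so the classes of \<open>G\<close> enter an elementary
  extension without raising the cardinality.\<close>

lemma skolem_ultrapower:
  fixes M :: "('f, 'r, 'a) struct" and G :: "('i \<Rightarrow> 'a) set"
  assumes lam: "Cinfinite lam" and big: "cardSuc lam \<le>o |UNIV :: 'a set|"
    and str: "is_struct V M" and cardM: "|univ M| =o lam"
    and Fb: "|fsyms V| \<le>o lam" and Rb: "|rsyms V| \<le>o lam"
    and U: "ultra U"
    and G: "|G| \<le>o lam" "\<forall>g \<in> G. \<forall>i. g i \<in> univ M"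
  shows "\<exists>N h. elem_submodel V M N \<and> |univ N| =o lam \<and> (\<forall>g \<in> G. h g \<in> univ N) \<and>
    (\<forall>a \<in> univ M. h (\<lambda>_. a) = a) \<and>
    (\<forall>gs \<in> lists (G \<union> (\<lambda>a _. a) ` univ M). \<forall>p \<in> formulas V (length gs).
      holds N p (map h gs) \<longleftrightarrow> eventually (\<lambda>i. holds M p (map (\<lambda>g. g i) gs)) U)"
proof -
  let ?k = "\<lambda>a (_ :: 'i). a"
  have cM: "|univ M| \<le>o lam" using cardM ordIso_imp_ordLeq by blast
  have Gk: "|G \<union> ?k ` univ M| \<le>o lam" by (intro Un_Cinfinite_bound G card_of_image_bound cM lam)
  have Gk': "\<forall>g \<in> G \<union> ?k ` univ M. \<forall>i. g i \<in> univ M" using G(2) by auto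
  obtain H where H0: "G \<union> ?k ` univ M \<subseteq> H" and H: "|H| \<le>o lam"
    and H1: "\<forall>g \<in> H. \<forall>i. g i \<in> univ M"
    and H2: "\<forall>p n gs. fm_over V p \<longrightarrow> gs \<in> lists H \<longrightarrow> (\<lambda>i. sk M p n (map (\<lambda>g. g i) gs)) \<in> H"
    and H3: "\<forall>f \<in> fsyms V. \<forall>gs \<in> lists H. length gs = far V f \<longrightarrow>
      (\<lambda>i. fint M f (map (\<lambda>g. g i) gs)) \<in> H"
    using skolem_hull[OF lam str Fb Rb Gk Gk'] by (elim exE conjE) (rule that)
  have GH: "G \<subseteq> H" "?k ` univ M \<subseteq> H" using H0 by auto
  have HM: "\<And>g i. g \<in> H \<Longrightarrow> g i \<in> univ M" using H1 by blast
  have skH: "\<And>p n gs. fm_over V p \<Longrightarrow> gs \<in> lists H \<Longrightarrow> (\<lambda>i. sk M p n (map (\<lambda>g. g i) gs)) \<in> H"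
    using H2 by blast
  have fnH: "\<And>f gs. f \<in> fsyms V \<Longrightarrow> gs \<in> lists H \<Longrightarrow> length gs = far V f \<Longrightarrow>
      (\<lambda>i. fint M f (map (\<lambda>g. g i) gs)) \<in> H" using H3 by blast
  have "\<exists>r. (\<forall>f \<in> H. \<forall>g \<in> H. r f = r g \<longleftrightarrow> eventually (\<lambda>i. f i = g i) U) \<and>
      (\<forall>a \<in> univ M. r (?k a) = a)"
    by (rule ex_representatives[OF lam big cM H])
      (rule eventually_eq_equiv, erule eventually_eq_equiv, erule (1) eventually_eq_equiv,
        simp add: ultra_const[OF U])
  then obtain r where r: "\<And>f g. f \<in> H \<Longrightarrow> g \<in> H \<Longrightarrow> r f = r g \<longleftrightarrow> eventually (\<lambda>i. f i = g i) U"
    and rk: "\<And>a. a \<in> univ M \<Longrightarrow> r (?k a) = a" by blast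
  \<comment> \<open>\<open>s x\<close> is a function in the class named \<open>x\<close>; it is
    needed because the operations of \<open>N\<close> must be defined on names.\<close>
  define s where "s x = (SOME g. g \<in> H \<and> r g = x)" for x
  have s: "s (r g) \<in> H" "r (s (r g)) = r g" if "g \<in> H" for g
    using someI_ex[of "\<lambda>h. h \<in> H \<and> r h = r g"] that by (auto simp: s_def)
  \<comment> \<open>The chosen function agrees with the given one only almost everywhere, but a list
    involves finitely many of them.\<close>
  have s_ev: "eventually (\<lambda>i. map (\<lambda>x. s x i) (map r gs) = map (\<lambda>g. g i) gs) U" if "gs \<in> lists H" for gs
  proof -
    have "eventually (\<lambda>i. \<forall>g \<in> set gs. s (r g) i = g i) U"
      by (rule eventually_ball_finite) (use that s r in auto)
    then show ?thesis by (rule eventually_mono) auto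
  qed
  define N :: "('f, 'r, 'a) struct" where
    "N = \<lparr>univ = r ` H, fint = \<lambda>f xs. r (\<lambda>i. fint M f (map (\<lambda>x. s x i) xs)),
      rint = \<lambda>R xs. eventually (\<lambda>i. rint M R (map (\<lambda>x. s x i) xs)) U\<rparr>"
  have univN: "univ N = r ` H" by (simp add: N_def)
  have fintN: "fint N f (map r gs) = r (\<lambda>i. fint M f (map (\<lambda>g. g i) gs))"
    if f: "f \<in> fsyms V" and gs: "gs \<in> lists H" and len: "length gs = far V f" for f gs
  proof -
    have "(\<lambda>i. fint M f (map (\<lambda>g. g i) (map (\<lambda>g. s (r g)) gs))) \<in> H"
      by (rule fnH[OF f]) (use gs s len in auto)
    moreover have "(\<lambda>i. fint M f (map (\<lambda>g. g i) gs)) \<in> H" by (rule fnH[OF f gs len])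
    moreover have "eventually (\<lambda>i. fint M f (map (\<lambda>x. s x i) (map r gs)) = fint M f (map (\<lambda>g. g i) gs)) U"
      using s_ev[OF gs] by (rule eventually_mono) (simp only:)
    ultimately show ?thesis by (simp add: N_def r comp_def)
  qed
  have rintN: "rint N R (map r gs) \<longleftrightarrow> eventually (\<lambda>i. rint M R (map (\<lambda>g. g i) gs)) U"
    if gs: "gs \<in> lists H" for R gs
  proof -
    have "eventually (\<lambda>i. rint M R (map (\<lambda>x. s x i) (map r gs)) = rint M R (map (\<lambda>g. g i) gs)) U"
      using s_ev[OF gs] by (rule eventually_mono) (simp only:)
    then have "eventually (\<lambda>i. rint M R (map (\<lambda>x. s x i) (map r gs))) U \<longleftrightarrow>
        eventually (\<lambda>i. rint M R (map (\<lambda>g. g i) gs)) U" by (rule eventually_subst)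
    then show ?thesis by (simp only: N_def struct.simps)
  qed
  have ne: "univ M \<noteq> {}" using str by (simp add: is_struct_def)
  then have Hne: "H \<noteq> {}" using GH(2) by blast
  have Los: "holds N p (map r gs) \<longleftrightarrow> eventually (\<lambda>i. holds M p (map (\<lambda>g. g i) gs)) U"
    if "gs \<in> lists H" "p \<in> formulas V (length gs)" for p gs
    by (rule Los_holds[where V = V and M = M and N = N and U = U and H = H and r = r])
      (fact U HM skH fnH r univN fintN rintN that Hne)+
  have MN: "univ M \<subseteq> univ N"
  proof
    fix a assume a: "a \<in> univ M"
    then have "?k a \<in> H" using GH(2) by blast
    then show "a \<in> univ N" using rk[OF a] unfolding univN by (metis image_eqI)
  qed
  have kH: "?k a \<in> H" if "a \<in> univ M" for a using GH(2) that by blast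
  have const_tuple: "map ?k ys \<in> lists H" "map r (map ?k ys) = ys" if "ys \<in> lists (univ M)" for ys
    using that kH rk by (auto intro!: map_idI)
  have strN: "is_struct V N"
    unfolding is_struct_def
  proof (intro conjI ballI impI)
    show "univ N \<noteq> {}" using univN Hne by simp
  next
    fix f xs assume f: "f \<in> fsyms V" and "xs \<in> lists (univ N)" and len: "length xs = far V f"
    then obtain gs where gs: "gs \<in> lists H" "xs = map r gs" using univN by (metis lists_imageE)
    then show "fint N f xs \<in> univ N" using fintN[OF f gs(1)] fnH[OF f gs(1)] len univN by simp
  qed
  have "submodel V M N"
    unfolding submodel_def
  proof (intro conjI ballI impI str strN MN)
    fix f ys assume f: "f \<in> fsyms V" and ys: "ys \<in> lists (univ M)" and len: "length ys = far V f"
    have "fint N f ys = r (\<lambda>i. fint M f ys)"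
      using fintN[OF f const_tuple(1)[OF ys]] len const_tuple(2)[OF ys] by (simp add: comp_def)
    also have "\<dots> = fint M f ys" using str f ys len by (intro rk) (simp add: is_struct_def)
    finally show "fint M f ys = fint N f ys" by simp
  next
    fix R ys assume ys: "ys \<in> lists (univ M)"
    show "rint M R ys = rint N R ys"
      using rintN[OF const_tuple(1)[OF ys], of R] const_tuple(2)[OF ys] ultra_const[OF U] by (simp add: comp_def)
  qed
  moreover have "holds M p ys \<longleftrightarrow> holds N p ys"
    if ys: "ys \<in> lists (univ M)" and p: "p \<in> formulas V (length ys)" for ys p
    using Los[OF const_tuple(1)[OF ys]] p const_tuple(2)[OF ys] ultra_const[OF U] by (simp add: comp_def)
  ultimately have "elem_submodel V M N" by (simp add: elem_submodel_def)
  moreover have "|univ N| =o lam"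
  proof -
    have "|univ N| \<le>o lam" unfolding univN by (rule card_of_image_bound[OF H])
    moreover have "lam \<le>o |univ N|"
      using MN cardM by (meson card_of_mono1 ordIso_ordLeq_trans ordIso_symmetric)
    ultimately show ?thesis by (simp add: ordIso_iff_ordLeq)
  qed
  moreover have "\<forall>g \<in> G. r g \<in> univ N" using GH(1) univN by blast
  moreover have "\<forall>gs \<in> lists (G \<union> ?k ` univ M). \<forall>p \<in> formulas V (length gs).
      holds N p (map r gs) \<longleftrightarrow> eventually (\<lambda>i. holds M p (map (\<lambda>g. g i) gs)) U"
    using Los lists_mono[OF H0] by blast
  moreover have "\<forall>a \<in> univ M. r (?k a) = a" using rk by blast
  ultimately show ?thesis by (intro exI[of _ N] exI[of _ r] conjI)
qed

text \<open>The new tuple \<open>d\<close> realises the average type of the \<open>c \<epsilon>\<close> along the ultrafilter \<open>D\<close>; in the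
  Skolem ultrapower modulo \<open>D\<close> it is the class of the sequence \<open>c\<close> itself.\<close>

lemma extension_average:
  fixes M :: "('f, 'r, 'a) struct" and c :: "'e \<Rightarrow> 'a list"
  assumes lam: "Cinfinite lam" and big: "cardSuc lam \<le>o |UNIV :: 'a set|"
    and str: "is_struct V M" and cardM: "|univ M| =o lam"
    and Fb: "|fsyms V| \<le>o lam" and Rb: "|rsyms V| \<le>o lam"
    and phi: "\<phi> \<in> formulas V (k + m)"
    and D: "ultra D" "eventually (\<lambda>\<epsilon>. \<epsilon> \<in> K) D"
    and c: "\<And>\<epsilon>. \<epsilon> \<in> K \<Longrightarrow> c \<epsilon> \<in> lists (univ M) \<and> length (c \<epsilon>) = k"
  shows "\<exists>N d. elem_submodel V M N \<and> |univ N| =o lam \<and> d \<in> lists (univ N) \<and> length d = k \<and>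
    (\<forall>b \<in> lists (univ M). length b = m \<longrightarrow>
      (holds N \<phi> (d @ b) \<longleftrightarrow> eventually (\<lambda>\<epsilon>. holds M \<phi> (c \<epsilon> @ b)) D))"
proof -
  obtain x where x: "x \<in> univ M" using str by (auto simp: is_struct_def)
  \<comment> \<open>Constant tuples make \<open>c\<close> total; \<open>D\<close> ignores them since
    it contains \<open>K\<close>.\<close>
  define c' where "c' \<epsilon> = (if \<epsilon> \<in> K then c \<epsilon> else replicate k x)" for \<epsilon>
  have c': "c' \<epsilon> \<in> lists (univ M)" "length (c' \<epsilon>) = k" for \<epsilon> using c x by (auto simp: c'_def in_listsD)
  define q where "q = (\<lambda>l \<epsilon>. c' \<epsilon> ! l)"
  have "c' \<epsilon> ! l \<in> univ M" if "l < k" for l \<epsilon>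
    using lists_nth[OF c'(1)[of \<epsilon>]] c'(2)[of \<epsilon>] that by simp
  then have qM: "\<forall>g \<in> q ` {..<k}. \<forall>\<epsilon>. g \<epsilon> \<in> univ M" by (auto simp: q_def)
  have qb: "|q ` {..<k}| \<le>o lam" by (intro card_of_finite_bound lam) simp
  obtain N h where N: "elem_submodel V M N" "|univ N| =o lam"
    and h: "\<forall>g \<in> q ` {..<k}. h g \<in> univ N" "\<forall>a \<in> univ M. h (\<lambda>_. a) = a"
    and Los: "\<forall>gs \<in> lists (q ` {..<k} \<union> (\<lambda>a _. a) ` univ M). \<forall>p \<in> formulas V (length gs).
      holds N p (map h gs) \<longleftrightarrow> eventually (\<lambda>i. holds M p (map (\<lambda>g. g i) gs)) D"
    using skolem_ultrapower[OF lam big str cardM Fb Rb D(1) qb qM] by (elim exE conjE) (rule that)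
  define d where "d = map h (map q [0..<k])"
  have "d \<in> lists (univ N)" "length d = k" using h(1) by (auto simp: d_def)
  moreover have "holds N \<phi> (d @ b) \<longleftrightarrow> eventually (\<lambda>\<epsilon>. holds M \<phi> (c \<epsilon> @ b)) D"
    if b: "b \<in> lists (univ M)" "length b = m" for b
  proof -
    let ?gs = "map q [0..<k] @ map (\<lambda>a _. a) b"
    have "map h ?gs = d @ b" using b h(2) by (auto simp: d_def map_idI)
    moreover have "map (\<lambda>g. g \<epsilon>) ?gs = c' \<epsilon> @ b" for \<epsilon>
      using c'(2)[of \<epsilon>] by (auto simp: q_def comp_def intro: map_nth)
    moreover have "?gs \<in> lists (q ` {..<k} \<union> (\<lambda>a _. a) ` univ M)" using b by auto
    moreover have "\<phi> \<in> formulas V (length ?gs)" using phi b by simp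
    ultimately have "holds N \<phi> (d @ b) \<longleftrightarrow> eventually (\<lambda>\<epsilon>. holds M \<phi> (c' \<epsilon> @ b)) D"
      using Los[THEN bspec, THEN bspec, of ?gs \<phi>] by (simp only:)
    also have "\<dots> \<longleftrightarrow> eventually (\<lambda>\<epsilon>. holds M \<phi> (c \<epsilon> @ b)) D"
      by (rule eventually_subst) (use D(2) in \<open>rule eventually_mono\<close>, simp add: c'_def)
    finally show ?thesis .
  qed
  ultimately show ?thesis using N by blast
qed

section \<open>Shattering, and infinite patterns by compactness\<close>

definition shatters :: "('f, 'r, 'a) struct \<Rightarrow> ('f, 'r) fm \<Rightarrow> nat \<Rightarrow> nat \<Rightarrow> bool" where
  "shatters M \<phi> k m \<longleftrightarrow> (\<forall>n. \<exists>b :: nat \<Rightarrow> 'a list.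
     (\<forall>l < n. b l \<in> lists (univ M) \<and> length (b l) = m) \<and>
     (\<forall>u \<subseteq> {..<n}. \<exists>x \<in> lists (univ M). length x = k \<and> (\<forall>l < n. holds M \<phi> (x @ b l) \<longleftrightarrow> l \<in> u)))"

text \<open>After \<open>F\<close> is enumerated, \<open>c \<epsilon>\<close> is a tuple cutting out
  exactly those members of \<open>F\<close> whose set \<open>A \<zeta>\<close> contains
  \<open>\<epsilon>\<close>. Outside \<open>F\<close>, \<open>b\<close> is a constant
  filler.\<close>

lemma shatters_finite:
  fixes A :: "'z \<Rightarrow> 'e set"
  assumes sh: "shatters M \<phi> k m" and x: "x \<in> univ M" and F: "finite F"
  shows "\<exists>b c. (\<forall>\<zeta>. b \<zeta> \<in> lists (univ M) \<and> length (b \<zeta>) = m) \<and>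
    (\<forall>\<epsilon>. c \<epsilon> \<in> lists (univ M) \<and> length (c \<epsilon>) = k) \<and>
    (\<forall>\<zeta> \<in> F. \<forall>\<epsilon>. holds M \<phi> (c \<epsilon> @ b \<zeta>) \<longleftrightarrow> \<epsilon> \<in> A \<zeta>)"
proof -
  obtain h where h: "bij_betw h F {0..<card F}" using ex_bij_betw_finite_nat[OF F] by blast
  obtain b where b: "\<And>l. l < card F \<Longrightarrow> b l \<in> lists (univ M) \<and> length (b l) = m"
    and u: "\<And>u. u \<subseteq> {..<card F} \<Longrightarrow> \<exists>x \<in> lists (univ M). length x = k \<and>
      (\<forall>l < card F. holds M \<phi> (x @ b l) \<longleftrightarrow> l \<in> u)"
    using sh unfolding shatters_def by metis
  define b' where "b' \<zeta> = (if \<zeta> \<in> F then b (h \<zeta>) else replicate m x)" for \<zeta>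
  have hF: "h \<zeta> < card F" if "\<zeta> \<in> F" for \<zeta> using h that by (auto simp: bij_betw_def)
  have "\<exists>y. y \<in> lists (univ M) \<and> length y = k \<and> (\<forall>\<zeta> \<in> F. holds M \<phi> (y @ b' \<zeta>) \<longleftrightarrow> \<epsilon> \<in> A \<zeta>)" for \<epsilon>
  proof -
    have "h ` {\<zeta> \<in> F. \<epsilon> \<in> A \<zeta>} \<subseteq> {..<card F}" using hF by auto
    from u[OF this] obtain y where y: "y \<in> lists (univ M)" "length y = k"
      "\<And>l. l < card F \<Longrightarrow> holds M \<phi> (y @ b l) \<longleftrightarrow> l \<in> h ` {\<zeta> \<in> F. \<epsilon> \<in> A \<zeta>}" by blast
    have "h \<zeta> \<in> h ` {\<zeta> \<in> F. \<epsilon> \<in> A \<zeta>} \<longleftrightarrow> \<epsilon> \<in> A \<zeta>" if "\<zeta> \<in> F" for \<zeta>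
      using h that by (auto simp: bij_betw_def inj_on_def)
    then show ?thesis using y hF by (auto simp: b'_def)
  qed
  then obtain c where "\<And>\<epsilon>. c \<epsilon> \<in> lists (univ M) \<and> length (c \<epsilon>) = k \<and>
      (\<forall>\<zeta> \<in> F. holds M \<phi> (c \<epsilon> @ b' \<zeta>) \<longleftrightarrow> \<epsilon> \<in> A \<zeta>)" by metis
  moreover have "b' \<zeta> \<in> lists (univ M) \<and> length (b' \<zeta>) = m" for \<zeta>
    using b hF x by (auto simp: b'_def in_listsD)
  ultimately show ?thesis by blast
qed

text \<open>Compactness by an ultrapower indexed by the finite subsets \<open>F\<close> of
  \<open>Z\<close>: the new tuples are the classes of the solutions found for each
  \<open>F\<close>.\<close>

lemma extension_pattern:
  fixes M :: "('f, 'r, 'a) struct" and A :: "'z \<Rightarrow> 'e set"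
  assumes lam: "Cinfinite lam" and big: "cardSuc lam \<le>o |UNIV :: 'a set|"
    and str: "is_struct V M" and cardM: "|univ M| =o lam"
    and Fb: "|fsyms V| \<le>o lam" and Rb: "|rsyms V| \<le>o lam"
    and phi: "\<phi> \<in> formulas V (k + m)" and sh: "shatters M \<phi> k m"
    and Z: "|Z| \<le>o lam" and K: "|K| \<le>o lam"
  shows "\<exists>N b c. elem_submodel V M N \<and> |univ N| =o lam \<and>
    (\<forall>\<zeta> \<in> Z. b \<zeta> \<in> lists (univ N) \<and> length (b \<zeta>) = m) \<and>
    (\<forall>\<epsilon> \<in> K. c \<epsilon> \<in> lists (univ N) \<and> length (c \<epsilon>) = k) \<and>
    (\<forall>\<zeta> \<in> Z. \<forall>\<epsilon> \<in> K. holds N \<phi> (c \<epsilon> @ b \<zeta>) \<longleftrightarrow> \<epsilon> \<in> A \<zeta>)"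
proof -
  obtain x where x: "x \<in> univ M" using str by (auto simp: is_struct_def)
  have "\<exists>b c. (\<forall>\<zeta>. b \<zeta> \<in> lists (univ M) \<and> length (b \<zeta>) = m) \<and>
    (\<forall>\<epsilon>. c \<epsilon> \<in> lists (univ M) \<and> length (c \<epsilon>) = k) \<and>
    (finite F \<longrightarrow> (\<forall>\<zeta> \<in> F. \<forall>\<epsilon>. holds M \<phi> (c \<epsilon> @ b \<zeta>) \<longleftrightarrow> \<epsilon> \<in> A \<zeta>))" for F
  proof (cases "finite F")
    case True
    from shatters_finite[OF sh x this, of A] show ?thesis by blast
  next
    case False
    then show ?thesis using x
      by (intro exI[of _ "\<lambda>_. replicate m x"] exI[of _ "\<lambda>_. replicate k x"]) auto
  qed
  then obtain b c where b: "\<And>F \<zeta>. b F \<zeta> \<in> lists (univ M) \<and> length (b F \<zeta>) = m"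
    and c: "\<And>F \<epsilon>. c F \<epsilon> \<in> lists (univ M) \<and> length (c F \<epsilon>) = k"
    and bc: "\<And>F \<zeta> \<epsilon>. finite F \<Longrightarrow> \<zeta> \<in> F \<Longrightarrow> holds M \<phi> (c F \<epsilon> @ b F \<zeta>) \<longleftrightarrow> \<epsilon> \<in> A \<zeta>" by metis
  obtain U where U: "U \<le> finite_subsets_at_top Z" "ultra U"
    using ex_ultra[of "finite_subsets_at_top Z"] by auto
  \<comment> \<open>\<open>U\<close> contains every cone of finite sets above a point of
    \<open>Z\<close>, so for fixed \<open>\<zeta>\<close> the solution for \<open>F\<close> is
    correct almost everywhere.\<close>
  have ev: "eventually (\<lambda>F. finite F \<and> \<zeta> \<in> F) U" if "\<zeta> \<in> Z" for \<zeta>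
    using U(1) by (rule filter_leD) (use that in \<open>auto simp: eventually_finite_subsets_at_top intro!: exI[of _ "{\<zeta>}"]\<close>)
  define q where "q = (\<lambda>(\<zeta>, l) F. b F \<zeta> ! l)"
  define s where "s = (\<lambda>(\<epsilon>, l) F. c F \<epsilon> ! l)"
  define G where "G = q ` (Z \<times> {..<m}) \<union> s ` (K \<times> {..<k})"
  have Gb: "|G| \<le>o lam" unfolding G_def
    by (intro Un_Cinfinite_bound card_of_image_bound card_of_Times_bound lam Z K card_of_finite_bound
        finite_lessThan)
  have "b F \<zeta> ! l \<in> univ M" if "l < m" for F \<zeta> l
    using lists_nth[of "b F \<zeta>" "univ M" l] b[of F \<zeta>] that by blast
  moreover have "c F \<epsilon> ! l \<in> univ M" if "l < k" for F \<epsilon> l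
    using lists_nth[of "c F \<epsilon>" "univ M" l] c[of F \<epsilon>] that by blast
  ultimately have GM: "\<forall>g \<in> G. \<forall>F. g F \<in> univ M" by (auto simp: G_def q_def s_def)
  obtain N h where N: "elem_submodel V M N" "|univ N| =o lam"
    and h: "\<forall>g \<in> G. h g \<in> univ N" and "\<forall>a \<in> univ M. h (\<lambda>_. a) = a"
    and Los: "\<forall>gs \<in> lists (G \<union> (\<lambda>a _. a) ` univ M). \<forall>p \<in> formulas V (length gs).
      holds N p (map h gs) \<longleftrightarrow> eventually (\<lambda>i. holds M p (map (\<lambda>g. g i) gs)) U"
    using skolem_ultrapower[OF lam big str cardM Fb Rb U(2) Gb GM] by (elim exE conjE) (rule that)
  define b' where "b' \<zeta> = map h (map (\<lambda>l. q (\<zeta>, l)) [0..<m])" for \<zeta>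
  define c' where "c' \<epsilon> = map h (map (\<lambda>l. s (\<epsilon>, l)) [0..<k])" for \<epsilon>
  have "b' \<zeta> \<in> lists (univ N) \<and> length (b' \<zeta>) = m" if "\<zeta> \<in> Z" for \<zeta>
    using that h by (auto simp: b'_def G_def)
  moreover have "c' \<epsilon> \<in> lists (univ N) \<and> length (c' \<epsilon>) = k" if "\<epsilon> \<in> K" for \<epsilon>
    using that h by (auto simp: c'_def G_def)
  moreover have "holds N \<phi> (c' \<epsilon> @ b' \<zeta>) \<longleftrightarrow> \<epsilon> \<in> A \<zeta>" if z: "\<zeta> \<in> Z" and e: "\<epsilon> \<in> K" for \<zeta> \<epsilon>
  proof -
    let ?gs = "map (\<lambda>l. s (\<epsilon>, l)) [0..<k] @ map (\<lambda>l. q (\<zeta>, l)) [0..<m]"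
    have "map h ?gs = c' \<epsilon> @ b' \<zeta>" by (simp add: c'_def b'_def)
    moreover have "map (\<lambda>g. g F) ?gs = c F \<epsilon> @ b F \<zeta>" for F
      using c[of F \<epsilon>] b[of F \<zeta>] by (auto simp: q_def s_def comp_def intro: map_nth)
    moreover have "?gs \<in> lists (G \<union> (\<lambda>a _. a) ` univ M)" using z e by (auto simp: G_def)
    moreover have "\<phi> \<in> formulas V (length ?gs)" using phi by simp
    ultimately have "holds N \<phi> (c' \<epsilon> @ b' \<zeta>) \<longleftrightarrow> eventually (\<lambda>F. holds M \<phi> (c F \<epsilon> @ b F \<zeta>)) U"
      using Los[THEN bspec, THEN bspec, of ?gs \<phi>] by (simp only:)
    also have "\<dots> \<longleftrightarrow> eventually (\<lambda>F. \<epsilon> \<in> A \<zeta>) U"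
      by (rule eventually_subst) (use ev[OF z] in \<open>rule eventually_mono\<close>, simp add: bc)
    finally show ?thesis by (simp add: ultra_const[OF U(2)])
  qed
  ultimately show ?thesis using N by blast
qed

section \<open>Independent families\<close>

text \<open>The index set of Hausdorff's independent family: a finite subset of \<open>S\<close>
  together with finitely many candidate traces on it. Lists stand for finite sets so that the bounds
  on lists apply.\<close>

definition finite_traces :: "'k set \<Rightarrow> ('k list \<times> 'k list list) set" where
  "finite_traces S = lists S \<times> lists (lists S)"

definition trace_set :: "'k set \<Rightarrow> 'k set \<Rightarrow> ('k list \<times> 'k list list) set" where
  "trace_set S Y = {(xs, yss) \<in> finite_traces S. Y \<inter> set xs \<in> set ` set yss}"

text \<open>Finitely many sets are separated by a finite \<open>B\<close>. The index consisting of
  \<open>B\<close> and the traces on \<open>B\<close> of the sets in \<open>X\<close> lies in the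
  trace sets of precisely those, which gives the finite intersection property.\<close>

lemma trace_sets_independent:
  assumes X: "X \<subseteq> Pow S"
  shows "\<exists>D. ultra D \<and> eventually (\<lambda>\<epsilon>. \<epsilon> \<in> finite_traces S) D \<and>
    (\<forall>Y \<in> Pow S. eventually (\<lambda>\<epsilon>. \<epsilon> \<in> trace_set S Y) D \<longleftrightarrow> Y \<in> X)"
proof -
  define P where "P Y = (if Y \<in> X then trace_set S Y else finite_traces S - trace_set S Y)" for Y
  have "(INF Y\<in>Pow S. principal (P Y)) \<noteq> bot"
  proof (rule INF_filter_not_bot)
    fix Q assume Q: "Q \<subseteq> Pow S" "finite Q"
    define w where "w Y Y' = (SOME x. x \<in> (Y - Y') \<union> (Y' - Y))" for Y Y' :: "'a set"
    have w: "w Y Y' \<in> (Y - Y') \<union> (Y' - Y)" if "Y \<noteq> Y'" for Y Y'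
      unfolding w_def by (rule someI_ex) (use that in blast)
    \<comment> \<open>One separating point per pair; the intersection with \<open>S\<close> discards
      the unspecified diagonal values \<open>w Y Y\<close> lying outside \<open>S\<close>.\<close>
    define B where "B = (\<lambda>(Y, Y'). w Y Y') ` (Q \<times> Q) \<inter> S"
    have "finite B" using Q by (simp add: B_def)
    then obtain xs where xs: "set xs = B" using finite_list by blast
    have "finite ((\<lambda>Y. Y \<inter> B) ` (Q \<inter> X))" using Q by simp
    from finite_list[OF this] obtain l where l: "set l = (\<lambda>Y. Y \<inter> B) ` (Q \<inter> X)" ..
    have "\<exists>ys. set ys = Y" if "Y \<in> set l" for Y
      by (rule finite_list) (use that l \<open>finite B\<close> in auto)
    then obtain f where f: "\<And>Y. Y \<in> set l \<Longrightarrow> set (f Y) = Y" by metis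
    have fl: "set ` set (map f l) = set l" using f by (auto simp: image_iff)
    have tr: "(xs, map f l) \<in> finite_traces S"
      using xs l f by (auto simp: finite_traces_def B_def)
    have "(xs, map f l) \<in> P Y" if Y: "Y \<in> Q" for Y
    proof -
      have "Y \<inter> B \<in> set l \<longleftrightarrow> Y \<in> X"
      proof
        assume "Y \<inter> B \<in> set l"
        then obtain Y' where Y': "Y' \<in> Q" "Y' \<in> X" "Y \<inter> B = Y' \<inter> B" using l by auto
        have "Y = Y'"
        proof (rule ccontr)
          assume ne: "Y \<noteq> Y'"
          have "w Y Y' \<in> B" using w[OF ne] Y Y' Q by (force simp: B_def)
          then show False using w[OF ne] Y'(3) by blast
        qed
        then show "Y \<in> X" using Y' by simp
      next
        assume "Y \<in> X" then show "Y \<inter> B \<in> set l" using l Y by blast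
      qed
      then show ?thesis using tr by (simp add: P_def trace_set_def xs fl del: set_map)
    qed
    then have "(\<Inter>Y\<in>Q. P Y) \<noteq> {}" by blast
    then show "(INF Y\<in>Q. principal (P Y)) \<noteq> bot"
      using Q(2) by (simp add: INF_principal_finite principal_eq_bot_iff)
  qed
  from ex_ultra[OF this] obtain D where D: "D \<le> (INF Y\<in>Pow S. principal (P Y))" "ultra D" by blast
  have ev: "eventually (\<lambda>\<epsilon>. \<epsilon> \<in> P Y) D" if "Y \<in> Pow S" for Y
    using D(1) that by (meson INF_lower eventually_principal filter_leD order_trans)
  have "eventually (\<lambda>\<epsilon>. \<epsilon> \<in> trace_set S Y) D \<longleftrightarrow> Y \<in> X" if Y: "Y \<in> Pow S" for Y
  proof (cases "Y \<in> X")
    case True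
    then show ?thesis using ev[OF Y] by (simp add: P_def)
  next
    case False
    have "eventually (\<lambda>\<epsilon>. \<epsilon> \<notin> trace_set S Y) D"
      using ev[OF Y] by (rule eventually_mono) (simp add: P_def False)
    then show ?thesis using False by (simp add: ultra_not[OF D(2)])
  qed
  moreover have "eventually (\<lambda>\<epsilon>. \<epsilon> \<in> finite_traces S) D"
    using ev[OF Pow_bottom] by (rule eventually_mono) (auto simp: P_def trace_set_def split: if_splits)
  ultimately show ?thesis using D(2) by blast
qed

lemma card_of_finite_traces_bound: "Cinfinite r \<Longrightarrow> |S| \<le>o r \<Longrightarrow> |finite_traces S| \<le>o r"
  unfolding finite_traces_def by (intro card_of_Times_bound card_of_lists_bound)

section \<open>Coded sets\<close>

lemma elem_submodel_holds:
  assumes "elem_submodel V M N" "xs \<in> lists (univ M)" "p \<in> formulas V (length xs)"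
  shows "holds M p xs \<longleftrightarrow> holds N p xs"
  using assms by (simp add: elem_submodel_def)

lemma elem_submodel_univ: "elem_submodel V M N \<Longrightarrow> univ M \<subseteq> univ N"
  by (simp add: elem_submodel_def submodel_def)

lemma elem_submodel_trans:
  assumes MN: "elem_submodel V M N" and NP: "elem_submodel V N P"
  shows "elem_submodel V M P"
proof -
  have sub: "lists (univ M) \<subseteq> lists (univ N)" using elem_submodel_univ[OF MN] by (rule lists_mono)
  have "submodel V M N" "submodel V N P" using MN NP by (simp_all add: elem_submodel_def)
  then have "submodel V M P" using sub unfolding submodel_def by (auto simp: subset_iff)
  moreover have "holds M p xs \<longleftrightarrow> holds P p xs" if "xs \<in> lists (univ M)" "p \<in> formulas V (length xs)" for xs p
    using elem_submodel_holds[OF MN that] elem_submodel_holds[OF NP _ that(2)] sub that(1) by blast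
  ultimately show ?thesis by (simp add: elem_submodel_def)
qed

lemma elem_submodel_EC_card:
  assumes T: "T \<subseteq> sentences V" and M: "M \<in> EC_card V T lam"
    and MN: "elem_submodel V M N" and N: "|univ N| =o lam"
  shows "N \<in> EC_card V T lam"
proof -
  have "holds N p []" if "p \<in> T" for p
    using elem_submodel_holds[OF MN, of "[]" p] T that M by (auto simp: EC_card_def EC_def)
  moreover have "is_struct V N" using MN by (simp add: elem_submodel_def submodel_def)
  ultimately show ?thesis using N by (simp add: EC_card_def EC_def)
qed

definition pattern ::
  "('f, 'r, 'a) struct \<Rightarrow> ('f, 'r) fm \<Rightarrow> nat \<Rightarrow> nat \<Rightarrow> 's set \<Rightarrow> 's set set \<Rightarrow>
    ('s set \<Rightarrow> 'a list) \<Rightarrow> ('s list \<times> 's list list \<Rightarrow> 'a list) \<Rightarrow> bool" where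
  "pattern M \<phi> k m S Z b c \<longleftrightarrow>
    (\<forall>\<zeta> \<in> Z. b \<zeta> \<in> lists (univ M) \<and> length (b \<zeta>) = m) \<and>
    (\<forall>\<epsilon> \<in> finite_traces S. c \<epsilon> \<in> lists (univ M) \<and> length (c \<epsilon>) = k) \<and>
    (\<forall>\<zeta> \<in> Z. \<forall>\<epsilon> \<in> finite_traces S. holds M \<phi> (c \<epsilon> @ b \<zeta>) \<longleftrightarrow> \<epsilon> \<in> trace_set S \<zeta>)"

lemma pattern_mono:
  assumes MN: "elem_submodel V M N" and phi: "\<phi> \<in> formulas V (k + m)"
    and pat: "pattern M \<phi> k m S Z b c"
  shows "pattern N \<phi> k m S Z b c"
proof -
  have sub: "lists (univ M) \<subseteq> lists (univ N)" using elem_submodel_univ[OF MN] by (rule lists_mono)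
  have "holds N \<phi> (c \<epsilon> @ b \<zeta>) \<longleftrightarrow> holds M \<phi> (c \<epsilon> @ b \<zeta>)" if "\<zeta> \<in> Z" "\<epsilon> \<in> finite_traces S" for \<zeta> \<epsilon>
    using elem_submodel_holds[OF MN, of "c \<epsilon> @ b \<zeta>" \<phi>] that phi pat by (simp add: pattern_def)
  then show ?thesis using pat sub unfolding pattern_def by (meson subsetD)
qed

text \<open>The subset of \<open>Z\<close> that \<open>d\<close> cuts out on the tuples of \<open>P\<close>, a tuple being read as \<open>\<zeta>\<close> if its trace
  over the family \<open>c\<close> is the member of the independent family belonging to \<open>\<zeta>\<close>.\<close>

definition code ::
  "('f, 'r, 'a) struct \<Rightarrow> ('f, 'r, 'a) struct \<Rightarrow> ('f, 'r) fm \<Rightarrow> nat \<Rightarrow> 's set \<Rightarrow> 's set set \<Rightarrow>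
    ('s list \<times> 's list list \<Rightarrow> 'a list) \<Rightarrow> 'a list \<Rightarrow> 's set set" where
  "code P N \<phi> m S Z c d = {\<zeta> \<in> Z. \<exists>b \<in> lists (univ P). length b = m \<and>
     {\<epsilon> \<in> finite_traces S. holds N \<phi> (c \<epsilon> @ b)} = trace_set S \<zeta> \<and> holds N \<phi> (d @ b)}"

definition codes ::
  "('f, 'r) fm \<Rightarrow> nat \<Rightarrow> nat \<Rightarrow> 's set \<Rightarrow> 's set set \<Rightarrow>
    ('f, 'r, 'a) struct \<Rightarrow> ('f, 'r, 'a) struct \<Rightarrow> 's set set set" where
  "codes \<phi> k m S Z P N = {code P N \<phi> m S Z c d | c d.
     (\<forall>\<epsilon> \<in> finite_traces S. c \<epsilon> \<in> lists (univ N) \<and> length (c \<epsilon>) = k) \<and>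
     d \<in> lists (univ N) \<and> length d = k}"

text \<open>\<open>f\<close> renames the parameter tuples: the identity when only the outer model or
  the values of \<open>c\<close> off the index set change, \<open>map \<pi>\<close> when a map
  \<open>\<pi>\<close> of \<open>P\<close> is applied.\<close>

lemma code_cong:
  assumes "\<And>b. b \<in> lists (univ P) \<Longrightarrow> length b = m \<Longrightarrow>
      f b \<in> lists (univ P') \<and> length (f b) = m \<and>
      (\<forall>\<epsilon> \<in> finite_traces S. holds N \<phi> (c \<epsilon> @ b) \<longleftrightarrow> holds N' \<phi> (c' \<epsilon> @ f b)) \<and>
      (holds N \<phi> (d @ b) \<longleftrightarrow> holds N' \<phi> (d' @ f b))"
    and "lists (univ P') \<subseteq> f ` lists (univ P)" and "\<And>b. length (f b) = length b"
  shows "code P N \<phi> m S Z c d = code P' N' \<phi> m S Z c' d'"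
proof -
  have "(\<exists>b \<in> lists (univ P). length b = m \<and>
      {\<epsilon> \<in> finite_traces S. holds N \<phi> (c \<epsilon> @ b)} = trace_set S \<zeta> \<and> holds N \<phi> (d @ b)) \<longleftrightarrow>
    (\<exists>b \<in> lists (univ P'). length b = m \<and>
      {\<epsilon> \<in> finite_traces S. holds N' \<phi> (c' \<epsilon> @ b)} = trace_set S \<zeta> \<and> holds N' \<phi> (d' @ b))"
    (is "?L \<longleftrightarrow> ?R") for \<zeta>
  proof -
    have eq: "{\<epsilon> \<in> finite_traces S. holds N \<phi> (c \<epsilon> @ b)} = {\<epsilon> \<in> finite_traces S. holds N' \<phi> (c' \<epsilon> @ f b)}"
      if "b \<in> lists (univ P)" "length b = m" for b
      using assms(1)[OF that] by blast
    show ?thesis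
    proof
      assume ?L
      then obtain b where b: "b \<in> lists (univ P)" "length b = m"
        "{\<epsilon> \<in> finite_traces S. holds N \<phi> (c \<epsilon> @ b)} = trace_set S \<zeta>" "holds N \<phi> (d @ b)" by blast
      then show ?R using assms(1)[OF b(1,2)] eq[OF b(1,2)] by (intro bexI[of _ "f b"]) auto
    next
      assume ?R
      then obtain b' where b': "b' \<in> lists (univ P')" "length b' = m"
        "{\<epsilon> \<in> finite_traces S. holds N' \<phi> (c' \<epsilon> @ b')} = trace_set S \<zeta>" "holds N' \<phi> (d' @ b')" by blast
      obtain b where b: "b \<in> lists (univ P)" "b' = f b" using assms(2) b'(1) by blast
      then have "length b = m" using b'(2) assms(3) by simp
      then show ?L using assms(1)[OF b(1)] eq[OF b(1)] b b' by (intro bexI[of _ b]) auto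
    qed
  qed
  then show ?thesis unfolding code_def by blast
qed

lemma codes_mono:
  assumes MN: "elem_submodel V M N" and phi: "\<phi> \<in> formulas V (k + m)" and P: "univ P \<subseteq> univ M"
  shows "codes \<phi> k m S Z P M \<subseteq> codes \<phi> k m S Z P N"
proof
  fix X assume "X \<in> codes \<phi> k m S Z P M"
  then obtain c d where X: "X = code P M \<phi> m S Z c d"
    and c: "\<And>\<epsilon>. \<epsilon> \<in> finite_traces S \<Longrightarrow> c \<epsilon> \<in> lists (univ M) \<and> length (c \<epsilon>) = k"
    and d: "d \<in> lists (univ M)" "length d = k" unfolding codes_def by blast
  have sub: "lists (univ M) \<subseteq> lists (univ N)" "lists (univ P) \<subseteq> lists (univ M)"
    using elem_submodel_univ[OF MN] P by (auto simp: lists_mono)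
  have eq: "holds M \<phi> (x @ b) \<longleftrightarrow> holds N \<phi> (x @ b)"
    if "x \<in> lists (univ M)" "length x = k" "b \<in> lists (univ P)" "length b = m" for x b
    using elem_submodel_holds[OF MN, of "x @ b" \<phi>] that phi subsetD[OF sub(2)] by simp
  have "X = code P N \<phi> m S Z c d"
    unfolding X by (rule code_cong[where f = "\<lambda>b. b"]) (use eq c d in auto)
  then show "X \<in> codes \<phi> k m S Z P N" using c d subsetD[OF sub(1)] unfolding codes_def by blast
qed

text \<open>The parameter-free formulas \<open>x_i = x_i\<close> detect the length of the tuple, and
  moving the parameters does not affect them.\<close>

lemma tp_length:
  fixes V :: "('f, 'r) vocab"
  assumes "move_tp \<pi> (tp V c' A N1) = tp V c A N2"
  shows "length c' = length c"
proof -
  have in_tp: "(Eq (Var i) (Var i), []) \<in> tp V x A N \<longleftrightarrow> i < length x"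
    for i x and N :: "('f, 'r, 'a) struct"
    by (auto simp: tp_def formulas_def holds_def)
  have "i < length c' \<longleftrightarrow> i < length c" for i
  proof -
    have "(Eq (Var i) (Var i), []) \<in> move_tp \<pi> (tp V c' A N1) \<longleftrightarrow>
        (Eq (Var i) (Var i), []) \<in> tp V c' A N1"
      by (force simp: move_tp_def)
    then show ?thesis using assms in_tp by metis
  qed
  then show ?thesis by (meson linorder_neqE_nat less_irrefl)
qed

lemma tp_transfer:
  assumes mv: "move_tp \<pi> (tp V c' A N1) = tp V c A N2" and inj: "inj_on \<pi> A" "\<pi> ` A \<subseteq> A"
    and phi: "\<phi> \<in> formulas V (length c + length b)" and b: "b \<in> lists A"
  shows "holds N1 \<phi> (c' @ b) \<longleftrightarrow> holds N2 \<phi> (c @ map \<pi> b)"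
proof -
  have len: "length c' = length c" using mv by (rule tp_length)
  have b': "map \<pi> b \<in> lists A" using b inj(2) by (auto simp: image_subset_iff)
  have "holds N1 \<phi> (c' @ b) \<longleftrightarrow> (\<phi>, b) \<in> tp V c' A N1" using b phi len by (simp add: tp_def)
  also have "\<dots> \<longleftrightarrow> (\<phi>, map \<pi> b) \<in> move_tp \<pi> (tp V c' A N1)"
  proof
    assume "(\<phi>, map \<pi> b) \<in> move_tp \<pi> (tp V c' A N1)"
    then obtain b0 where b0: "(\<phi>, b0) \<in> tp V c' A N1" "map \<pi> b0 = map \<pi> b"
      by (auto simp: move_tp_def)
    moreover have "b0 \<in> lists A" using b0(1) by (simp add: tp_def)
    ultimately have "b0 = b" using b inj(1) by (metis inj_onD inj_on_map_lists)
    then show "(\<phi>, b) \<in> tp V c' A N1" using b0 by simp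
  qed (auto simp: move_tp_def)
  also have "\<dots> \<longleftrightarrow> holds N2 \<phi> (c @ map \<pi> b)" unfolding mv using b' phi by (simp add: tp_def)
  finally show ?thesis .
qed

text \<open>Each tuple \<open>x\<close> of \<open>N2\<close> has a partner \<open>g x\<close> in
  \<open>N1\<close> whose moved type is the type of \<open>x\<close>. Matching tuples one at a time
  suffices even for an infinite family \<open>c\<close>, because every instance of
  \<open>\<phi>\<close> involves a single member of it.\<close>

lemma codes_invariant:
  assumes bij: "bij_betw \<pi> (univ P) (univ P)" and phi: "\<phi> \<in> formulas V (k + m)"
    and mv: "move_tp \<pi> ` realized_tps V P N1 = realized_tps V P N2"
  shows "codes \<phi> k m S Z P N2 \<subseteq> codes \<phi> k m S Z P N1"
proof
  fix X assume "X \<in> codes \<phi> k m S Z P N2"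
  then obtain c d where X: "X = code P N2 \<phi> m S Z c d"
    and c: "\<And>\<epsilon>. \<epsilon> \<in> finite_traces S \<Longrightarrow> c \<epsilon> \<in> lists (univ N2) \<and> length (c \<epsilon>) = k"
    and d: "d \<in> lists (univ N2)" "length d = k" unfolding codes_def by blast
  have inj: "inj_on \<pi> (univ P)" "\<pi> ` univ P \<subseteq> univ P" using bij by (auto simp: bij_betw_def)
  have ex: "\<exists>y. y \<in> lists (univ N1) \<and> move_tp \<pi> (tp V y (univ P) N1) = tp V x (univ P) N2"
    if "x \<in> lists (univ N2)" for x
  proof -
    have "tp V x (univ P) N2 \<in> move_tp \<pi> ` realized_tps V P N1"
      unfolding mv using that by (auto simp: realized_tps_def)
    then show ?thesis by (auto simp: realized_tps_def)
  qed
  obtain g where g: "\<And>x. x \<in> lists (univ N2) \<Longrightarrow> g x \<in> lists (univ N1)"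
    "\<And>x. x \<in> lists (univ N2) \<Longrightarrow> move_tp \<pi> (tp V (g x) (univ P) N1) = tp V x (univ P) N2"
    using ex by metis
  have gl: "length (g x) = length x" if "x \<in> lists (univ N2)" for x
    using tp_length[OF g(2)[OF that]] .
  have eq: "holds N1 \<phi> (g x @ b) \<longleftrightarrow> holds N2 \<phi> (x @ map \<pi> b)"
    if "x \<in> lists (univ N2)" "length x = k" "b \<in> lists (univ P)" "length b = m" for x b
    by (rule tp_transfer[OF g(2)[OF that(1)] inj]) (use that phi in auto)
  have "code P N1 \<phi> m S Z (\<lambda>\<epsilon>. g (c \<epsilon>)) (g d) = code P N2 \<phi> m S Z c d"
  proof (rule code_cong[where f = "map \<pi>"])
    show "lists (univ P) \<subseteq> map \<pi> ` lists (univ P)"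
      using bij by (metis bij_betw_imp_surj_on lists_image order_refl)
  qed (use eq c d inj(2) in \<open>auto simp: image_subset_iff\<close>)
  then show "X \<in> codes \<phi> k m S Z P N1"
    unfolding X codes_def using c d g(1) gl by (intro CollectI exI[of _ "\<lambda>\<epsilon>. g (c \<epsilon>)"] exI[of _ "g d"]) auto
qed

lemma card_of_Func_bound:
  assumes kap: "|K| \<le>o \<kappa>" "K \<noteq> {}" and L: "|L| \<le>o lam"
  shows "|Func K L| \<le>o lam ^c \<kappa>"
proof -
  have "|L| ^c |K| \<le>o lam ^c \<kappa>"
  proof (rule cexp_mono[OF L kap(1)])
    \<comment> \<open>The side condition of monotonicity concerns an empty exponent, which
      \<open>K \<noteq> {}\<close> excludes.\<close>
    show "\<kappa> =o (czero :: 'z rel)" if "|K| =o (czero :: 'z rel)"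
      using that kap(2) by (simp add: card_of_ordIso_czero_iff_empty)
  qed (rule card_of_Card_order)
  then show ?thesis by (simp add: cexp_def Field_card_of)
qed

text \<open>A code is determined by a function from an index set of size at most
  \<open>\<kappa>\<close> into the finite sequences of \<open>N\<close>, and one further
  sequence.\<close>

lemma card_of_codes_bound:
  assumes lam: "Cinfinite lam" and kap: "Cinfinite \<kappa>" and S: "|S| \<le>o \<kappa>" and N: "|univ N| \<le>o lam"
  shows "|codes \<phi> k m S Z P N| \<le>o lam ^c \<kappa>"
proof -
  let ?K = "finite_traces S" and ?L = "lists (univ N)"
  have L: "|?L| \<le>o lam" by (rule card_of_lists_bound[OF lam N])
  have ne: "?K \<noteq> {}" by (auto simp: finite_traces_def)
  have r: "Cinfinite (lam ^c \<kappa>)"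
    by (rule Cinfinite_cexp) (use lam kap in \<open>auto intro: ctwo_ordLeq_Cinfinite\<close>)
  have le: "lam \<le>o lam ^c \<kappa>"
    by (rule ordLeq_cexp1) (use lam kap in \<open>auto simp: Cinfinite_Cnotzero\<close>)
  have "codes \<phi> k m S Z P N \<subseteq> (\<lambda>(c, d). code P N \<phi> m S Z c d) ` (Func ?K ?L \<times> ?L)"
  proof
    fix X assume "X \<in> codes \<phi> k m S Z P N"
    then obtain c d where X: "X = code P N \<phi> m S Z c d" and cd: "\<forall>\<epsilon> \<in> ?K. c \<epsilon> \<in> ?L" "d \<in> ?L"
      unfolding codes_def by blast
    let ?c = "\<lambda>\<epsilon>. if \<epsilon> \<in> ?K then c \<epsilon> else undefined"
    have "code P N \<phi> m S Z ?c d = X" unfolding X by (rule code_cong[where f = "\<lambda>b. b"]) auto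
    moreover have "?c \<in> Func ?K ?L" using cd by (auto simp: Func_def)
    ultimately show "X \<in> (\<lambda>(c, d). code P N \<phi> m S Z c d) ` (Func ?K ?L \<times> ?L)" using cd(2) by force
  qed
  moreover have "|Func ?K ?L \<times> ?L| \<le>o lam ^c \<kappa>"
    by (intro card_of_Times_bound r card_of_Func_bound card_of_finite_traces_bound kap S ne L
        ordLeq_transitive[OF L le])
  ultimately show ?thesis by (meson card_of_image_bound card_of_subset_bound)
qed

text \<open>A tuple of \<open>P\<close> read as \<open>\<zeta>\<close> satisfies
  \<open>\<phi>\<close> with the average \<open>d\<close> iff the trace set of
  \<open>\<zeta>\<close> is in \<open>D\<close>, that is, iff \<open>\<zeta> \<in> X\<close>.
  \<open>P\<close> must contain \<open>M0\<close> to supply the tuples \<open>b \<zeta>\<close>, and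
  lie inside \<open>M\<close> because averages are controlled at tuples of \<open>M\<close>
  only.\<close>

lemma extension_code:
  fixes M :: "('f, 'r, 'a) struct"
  assumes lam: "Cinfinite lam" and big: "cardSuc lam \<le>o |UNIV :: 'a set|"
    and str: "is_struct V M" and cardM: "|univ M| =o lam"
    and Fb: "|fsyms V| \<le>o lam" and Rb: "|rsyms V| \<le>o lam"
    and phi: "\<phi> \<in> formulas V (k + m)"
    and M0: "elem_submodel V M0 M" and pat: "pattern M0 \<phi> k m S Z b c"
    and Z: "Z \<subseteq> Pow S" and X: "X \<subseteq> Z"
  shows "\<exists>N. elem_submodel V M N \<and> |univ N| =o lam \<and>
    (\<forall>P. univ M0 \<subseteq> univ P \<and> univ P \<subseteq> univ M \<longrightarrow> X \<in> codes \<phi> k m S Z P N)"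
proof -
  let ?K = "finite_traces S"
  obtain D where D: "ultra D" "eventually (\<lambda>\<epsilon>. \<epsilon> \<in> ?K) D"
    and DX: "\<And>Y. Y \<in> Pow S \<Longrightarrow> eventually (\<lambda>\<epsilon>. \<epsilon> \<in> trace_set S Y) D \<longleftrightarrow> Y \<in> X"
    using trace_sets_independent[OF order_trans[OF X Z]] by blast
  have pM: "pattern M \<phi> k m S Z b c" by (rule pattern_mono[OF M0 phi pat])
  then have c: "\<And>\<epsilon>. \<epsilon> \<in> ?K \<Longrightarrow> c \<epsilon> \<in> lists (univ M) \<and> length (c \<epsilon>) = k" by (simp add: pattern_def)
  obtain N d where MN: "elem_submodel V M N" and N: "|univ N| =o lam"
    and d: "d \<in> lists (univ N)" "length d = k"
    and dD: "\<And>b. b \<in> lists (univ M) \<Longrightarrow> length b = m \<Longrightarrow>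
      holds N \<phi> (d @ b) \<longleftrightarrow> eventually (\<lambda>\<epsilon>. holds M \<phi> (c \<epsilon> @ b)) D"
    using extension_average[where c = c, OF lam big str cardM Fb Rb phi D c] by blast
  have sub: "lists (univ M) \<subseteq> lists (univ N)" using elem_submodel_univ[OF MN] by (rule lists_mono)
  have pN: "pattern N \<phi> k m S Z b c" by (rule pattern_mono[OF MN phi pM])
  have "X \<in> codes \<phi> k m S Z P N" if P: "univ M0 \<subseteq> univ P" "univ P \<subseteq> univ M" for P
  proof -
    have PM: "lists (univ P) \<subseteq> lists (univ M)" using P(2) by (rule lists_mono)
    have cut: "holds N \<phi> (d @ y) \<longleftrightarrow> \<zeta> \<in> X"
      if z: "\<zeta> \<in> Z" and y: "y \<in> lists (univ P)" "length y = m"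
        and tr: "{\<epsilon> \<in> ?K. holds N \<phi> (c \<epsilon> @ y)} = trace_set S \<zeta>" for \<zeta> y
    proof -
      have yM: "y \<in> lists (univ M)" using y PM by blast
      have "holds M \<phi> (c \<epsilon> @ y) \<longleftrightarrow> \<epsilon> \<in> trace_set S \<zeta>" if "\<epsilon> \<in> ?K" for \<epsilon>
        using elem_submodel_holds[OF MN, of "c \<epsilon> @ y" \<phi>] c[OF that] yM y(2) phi tr that by auto
      then have "eventually (\<lambda>\<epsilon>. holds M \<phi> (c \<epsilon> @ y) \<longleftrightarrow> \<epsilon> \<in> trace_set S \<zeta>) D"
        using D(2) by (rule eventually_mono[rotated])
      then have "eventually (\<lambda>\<epsilon>. holds M \<phi> (c \<epsilon> @ y)) D \<longleftrightarrow> eventually (\<lambda>\<epsilon>. \<epsilon> \<in> trace_set S \<zeta>) D"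
        by (rule eventually_subst)
      then show ?thesis using dD[OF yM y(2)] DX[of \<zeta>] z Z by blast
    qed
    have bz: "b \<zeta> \<in> lists (univ P)" "length (b \<zeta>) = m"
      "{\<epsilon> \<in> ?K. holds N \<phi> (c \<epsilon> @ b \<zeta>)} = trace_set S \<zeta>" if "\<zeta> \<in> Z" for \<zeta>
    proof -
      show "b \<zeta> \<in> lists (univ P)" "length (b \<zeta>) = m"
        using pat that lists_mono[OF P(1)] by (auto simp: pattern_def)
      show "{\<epsilon> \<in> ?K. holds N \<phi> (c \<epsilon> @ b \<zeta>)} = trace_set S \<zeta>"
        using pN that by (auto simp: pattern_def trace_set_def)
    qed
    have "code P N \<phi> m S Z c d = X"
    proof
      show "code P N \<phi> m S Z c d \<subseteq> X" using cut unfolding code_def by blast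
      show "X \<subseteq> code P N \<phi> m S Z c d"
      proof
        fix \<zeta> assume "\<zeta> \<in> X"
        then have z: "\<zeta> \<in> Z" using X by blast
        show "\<zeta> \<in> code P N \<phi> m S Z c d"
          unfolding code_def using cut[OF z bz[OF z]] bz[OF z] z \<open>\<zeta> \<in> X\<close> by blast
      qed
    qed
    moreover have "\<forall>\<epsilon> \<in> ?K. c \<epsilon> \<in> lists (univ N) \<and> length (c \<epsilon>) = k" using c sub by blast
    ultimately show ?thesis using d unfolding codes_def by blast
  qed
  then show ?thesis using MN N by blast
qed

section \<open>Successors and points of given cofinality\<close>

lemma osuc_props:
  assumes r: "Card_order r" "infinite (Field r)" and i: "i \<in> Field r"
  shows "osuc r i \<in> Field r" "(i, osuc r i) \<in> r" "osuc r i \<noteq> i"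
    and "\<And>j. i \<in> underS r j \<Longrightarrow> (osuc r i, j) \<in> r"
proof -
  have wo: "wo_rel r" using r(1) by (simp add: card_order_on_well_order_on wo_rel_def)
  obtain b where "b \<in> Field r" "i \<noteq> b" "(i, b) \<in> r" using infinite_Card_order_limit[OF r i] by blast
  then have ab: "AboveS r {i} \<noteq> {}" by (auto simp: AboveS_def)
  have B: "{i} \<subseteq> Field r" using i by simp
  show "osuc r i \<in> Field r" unfolding osuc_def by (rule wo_rel.suc_inField[OF wo B ab])
  show "(i, osuc r i) \<in> r" "osuc r i \<noteq> i"
    using wo_rel.suc_greater[OF wo B ab, of i] by (auto simp: osuc_def)
  show "(osuc r i, j) \<in> r" if "i \<in> underS r j" for j
    unfolding osuc_def
    by (rule wo_rel.suc_least_AboveS[OF wo]) (use that in \<open>auto simp: AboveS_def underS_def Field_def\<close>)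
qed

text \<open>Cofinality is strict: some member of a cofinal set lies strictly above \<open>i\<close>,
  and the successor of \<open>i\<close> is at most this member.\<close>

lemma has_cof_osuc:
  assumes r: "Card_order r" "infinite (Field r)" and cof: "has_cof r \<delta> \<mu>" and i: "i \<in> underS r \<delta>"
  shows "osuc r i \<in> underS r \<delta>"
proof -
  have wo: "wo_rel r" using r(1) by (simp add: card_order_on_well_order_on wo_rel_def)
  have iF: "i \<in> Field r" using i by (auto simp: underS_def Field_def)
  obtain K where K: "K \<subseteq> underS r \<delta>" "cofinal K (Restr r (underS r \<delta>))"
    using cof unfolding has_cof_def by blast
  have "(i, i) \<in> r" using wo_rel.REFL[OF wo] iF by (simp add: refl_on_def)
  then have "i \<in> Field (Restr r (underS r \<delta>))" using i by (auto simp: Field_def)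
  then obtain j where j: "j \<in> K" "i \<noteq> j" "(i, j) \<in> r" using K(2) unfolding cofinal_def by blast
  then have "(osuc r i, j) \<in> r" by (intro osuc_props(4)[OF r iF]) (simp add: underS_def)
  moreover have "j \<in> underS r \<delta>" using j K by blast
  ultimately show ?thesis
    using wo_rel.TRANS[OF wo] wo_rel.ANTISYM[OF wo] unfolding underS_def
    by (auto dest: transD antisymD)
qed

section \<open>The strategy\<close>

text \<open>The minimum is at most \<open>2^\<kappa>\<close>, so it is the size of some family
  \<open>Z\<close> of subsets of \<open>Field \<kappa>\<close>; its power set then has more than
  \<open>lam^\<kappa>\<close> members.\<close>

lemma cmin_witness:
  fixes lam :: "'l rel" and \<kappa> :: "'k rel"
  assumes lam: "Card_order lam" and kap: "Card_order \<kappa>"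
    and lt: "lam ^c \<kappa> <o ctwo ^c cmin (ctwo ^c \<kappa>) lam"
  shows "\<exists>Z \<subseteq> Pow (Field \<kappa>). |Z| \<le>o lam \<and> lam ^c \<kappa> <o |Pow Z|"
proof -
  let ?m = "cmin (ctwo ^c \<kappa>) lam"
  have co: "Card_order ?m" by (simp add: cmin_def card_of_Card_order)
  have pow: "ctwo ^c \<kappa> =o |Pow (Field \<kappa>)|"
    using ordIso_symmetric[OF card_of_Pow_Func[of "Field \<kappa>"]] by (simp add: cexp_def ctwo_def Field_card_of)
  have card_im: "|f ` Field r| \<le>o r" if "Card_order r" for f :: "'x \<Rightarrow> 'y" and r
    using card_of_image card_of_Field_ordIso[OF that] ordLeq_ordIso_trans by blast
  have "?m \<le>o lam" "?m \<le>o ctwo ^c \<kappa>"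
  proof -
    have c2: "Card_order (ctwo ^c \<kappa>)" by (rule Card_order_cexp)
    consider "ctwo ^c \<kappa> \<le>o lam" | "\<not> ctwo ^c \<kappa> \<le>o lam" "lam \<le>o ctwo ^c \<kappa>"
      using lam c2 by (meson card_order_on_well_order_on ordLeq_total)
    then have "?m \<le>o lam \<and> ?m \<le>o ctwo ^c \<kappa>"
    proof cases
      case 1
      then show ?thesis using card_im[OF c2, of Inl] ordLeq_transitive by (auto simp: cmin_def)
    next
      case 2
      then show ?thesis using card_im[OF lam, of Inr] ordLeq_transitive by (auto simp: cmin_def)
    qed
    then show "?m \<le>o lam" "?m \<le>o ctwo ^c \<kappa>" by auto
  qed
  then have "|Field ?m| \<le>o |Pow (Field \<kappa>)|"
    using card_of_Field_ordIso[OF co] pow by (meson ordIso_ordLeq_trans ordLeq_ordIso_trans)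
  from internalize_card_of_ordLeq2[THEN iffD1, OF this]
  obtain Z where Z: "Z \<subseteq> Pow (Field \<kappa>)" "|Field ?m| =o |Z|" by blast
  have mZ: "?m =o |Z|" using card_of_Field_ordIso[OF co] Z(2) by (meson ordIso_symmetric ordIso_transitive)
  have "|Z| \<le>o lam" using mZ \<open>?m \<le>o lam\<close> by (meson ordIso_ordLeq_trans ordIso_symmetric)
  moreover have "ctwo ^c ?m =o ctwo ^c |Z|"
    by (rule cexp_cong2[OF mZ Card_order_ctwo co])
  moreover have "ctwo ^c |Z| =o |Pow Z|"
    using ordIso_symmetric[OF card_of_Pow_Func[of Z]] by (simp add: cexp_def ctwo_def Field_card_of)
  ultimately show ?thesis using Z(1) lt by (meson ordLess_ordIso_trans)
qed

lemma card_of_under_cardSuc: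
  assumes lam: "Cinfinite lam" and i: "i \<in> Field (cardSuc lam)"
  shows "|under (cardSuc lam) i| \<le>o lam"
proof -
  have "|underS (cardSuc lam) i| <o cardSuc lam"
    by (rule card_of_underS) (use lam i cardSuc_Card_order in auto)
  then have "|underS (cardSuc lam) i| \<le>o lam"
    using cardSuc_ordLeq_ordLess[OF _ card_of_Card_order] lam by blast
  then have "|{i} \<union> underS (cardSuc lam) i| \<le>o lam"
    by (rule Un_Cinfinite_bound[OF card_of_finite_bound[OF lam] _ lam, rotated]) simp
  moreover have "under (cardSuc lam) i \<subseteq> {i} \<union> underS (cardSuc lam) i"
    by (auto simp: under_def underS_def)
  ultimately show ?thesis by (rule card_of_subset_bound[rotated])
qed

lemma Pr_theory_of_shatters:
  fixes V :: "('f, 'r) vocab" and T :: "('f, 'r) fm set" and lam :: "'l rel" and \<kappa> :: "'k rel"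
  assumes compl: "complete_theory TYPE('a) V T"
    and lam: "Cinfinite lam" and kap: "Cinfinite \<kappa>" and kl: "\<kappa> \<le>o lam"
    and lt: "lam ^c \<kappa> <o ctwo ^c cmin (ctwo ^c \<kappa>) lam"
    and Tl: "|T| \<le>o lam" and big: "cardSuc lam \<le>o |UNIV :: 'a set|"
    and phi: "\<phi> \<in> formulas V (k + m)"
    and sh: "\<And>M :: ('f, 'r, 'a) struct. M \<in> EC V T \<Longrightarrow> infinite (univ M) \<Longrightarrow> shatters M \<phi> k m"
  shows "Pr_theory TYPE('a) V T lam \<kappa>"
proof -
  define r where "r = cardSuc lam"
  have r: "Card_order r" "infinite (Field r)"
    using lam Cinfinite_cardSuc[OF lam] by (auto simp: r_def cinfinite_def)
  have wo: "wo_rel r" using r(1) by (simp add: card_order_on_well_order_on wo_rel_def)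
  have rrefl: "(i, i) \<in> r" if "i \<in> Field r" for i
    using wo_rel.REFL[OF wo] that by (simp add: refl_on_def)
  have rtrans: "(i, l) \<in> r" if "(i, j) \<in> r" "(j, l) \<in> r" for i j l
    using wo_rel.TRANS[OF wo] that by (blast dest: transD)
  have Fld: "i \<in> Field r" "j \<in> Field r" if "(i, j) \<in> r" for i j using that by (auto simp: Field_def)
  define S where "S = Field \<kappa>"
  have S: "|S| \<le>o \<kappa>" using kap card_of_Field_ordIso ordIso_imp_ordLeq S_def by blast
  obtain Z where Z: "Z \<subseteq> Pow S" "|Z| \<le>o lam" "lam ^c \<kappa> <o |Pow Z|"
    using cmin_witness[OF _ _ lt] lam kap S_def by blast
  have K: "|finite_traces S| \<le>o lam"
    by (rule card_of_finite_traces_bound[OF lam ordLeq_transitive[OF S kl]])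
  have T: "T \<subseteq> sentences V" using compl by (simp add: complete_theory_def)
  define coded where "coded = (codes \<phi> k m S Z ::
    ('f, 'r, 'a) struct \<Rightarrow> ('f, 'r, 'a) struct \<Rightarrow> 'k set set set)"
  define pat where "pat = (\<lambda>M :: ('f, 'r, 'a) struct. \<exists>b c. pattern M \<phi> k m S Z b c)"
  have pat_mono: "pat N" if "elem_submodel V M N" "pat M" for M N
    using that pattern_mono[OF _ phi] unfolding pat_def by blast
  obtain z where z: "z \<in> Field r" using r(2) by fastforce
  \<comment> \<open>Obedience binds only moves at successors. The first such move is at
    \<open>osuc r z\<close>, and its answer lies inside the model at the next index
    \<open>t\<close>.\<close>
  define t where "t = osuc r (osuc r z)"
  note osuc = osuc_props[OF r]
  have z1: "osuc r z \<in> Field r" by (rule osuc(1)[OF z])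
  have t: "t \<in> Field r" unfolding t_def by (rule osuc(1)[OF z1])
  \<comment> \<open>The demand on the answer \<open>N\<close> at stage \<open>i\<close>: it carries
    a pattern, and one set \<open>X\<close> is newly coded over all models from \<open>t\<close> to
    \<open>i\<close> at once. The clause \<open>pat (M t)\<close> is a premise because
    \<open>F\<close> must also answer sequences that ignored its earlier moves.\<close>
  define Q where "Q i M N \<longleftrightarrow> N \<in> EC_card V T lam \<and> elem_submodel V (M i) N \<and> pat N \<and>
    ((t, i) \<in> r \<and> pat (M t) \<longrightarrow>
      (\<exists>X. \<forall>\<alpha>. (t, \<alpha>) \<in> r \<and> (\<alpha>, i) \<in> r \<longrightarrow> X \<in> coded (M \<alpha>) N \<and> X \<notin> coded (M \<alpha>) (M i)))"
    for i :: "'l set" and M and N :: "('f, 'r, 'a) struct"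
  define F where "F i M = (SOME N. Q i M N)" for i M
  have ex: "\<exists>N. Q i M N"
    if i: "i \<in> Field r" and inc: "incr_cont V r (under r i) M"
      and EC: "\<And>j. j \<in> under r i \<Longrightarrow> M j \<in> EC_card V T lam" for i M
  proof -
    have ii: "i \<in> under r i" using rrefl[OF i] by (simp add: under_def)
    have Mi: "M i \<in> EC_card V T lam" "is_struct V (M i)" "|univ (M i)| =o lam"
      using EC[OF ii] by (auto simp: EC_card_def EC_def)
    have inf: "infinite (univ (M i))"
      using card_of_ordIso_finite_Field[OF _ ordIso_symmetric[OF Mi(3)]] lam by (simp add: cinfinite_def)
    have ECi: "M i \<in> EC V T" using Mi(1) by (simp add: EC_card_def)
    note b = card_of_vocab_bound[OF compl ECi inf lam Tl]
    obtain N1 where N1: "elem_submodel V (M i) N1" "|univ N1| =o lam" and p1: "pat N1"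
      using extension_pattern[OF lam big Mi(2,3) b phi sh[OF ECi inf] Z(2) K, of "trace_set S"]
      unfolding pat_def pattern_def by blast
    show ?thesis
    proof (cases "(t, i) \<in> r \<and> pat (M t)")
      case False
      then show ?thesis using N1 p1 elem_submodel_EC_card[OF T Mi(1) N1] unfolding Q_def by blast
    next
      case True
      have sub: "elem_submodel V (M \<alpha>) (M \<beta>)" if "(\<alpha>, \<beta>) \<in> r" "(\<beta>, i) \<in> r" for \<alpha> \<beta>
        using inc that rtrans unfolding incr_cont_def by (auto simp: under_def)
      have str1: "is_struct V N1" using N1(1) by (simp add: elem_submodel_def submodel_def)
      \<comment> \<open>Everything coded so far over any earlier model: at most \<open>lam\<close>
        families of at most \<open>lam^\<kappa>\<close> sets, too few to exhaust
        \<open>Pow Z\<close>.\<close>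
      define old where "old = (\<Union>\<alpha>\<in>under r i. coded (M \<alpha>) (M i))"
      have r': "Cinfinite (lam ^c \<kappa>)"
        by (rule Cinfinite_cexp) (use lam kap in \<open>auto intro: ctwo_ordLeq_Cinfinite\<close>)
      have "|old| \<le>o lam ^c \<kappa>"
        unfolding old_def
      proof (rule UNION_Cinfinite_bound[OF _ _ r'])
        have "lam \<le>o lam ^c \<kappa>"
          by (rule ordLeq_cexp1) (use lam kap in \<open>auto simp: Cinfinite_Cnotzero\<close>)
        then show "|under r i| \<le>o lam ^c \<kappa>"
          using card_of_under_cardSuc[OF lam] i ordLeq_transitive unfolding r_def by blast
        show "\<forall>\<alpha>\<in>under r i. |coded (M \<alpha>) (M i)| \<le>o lam ^c \<kappa>"
          unfolding coded_def using card_of_codes_bound[OF lam kap S ordIso_imp_ordLeq[OF Mi(3)]] by blast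
      qed
      then have "|old| <o |Pow Z|" using Z(3) ordLeq_ordLess_trans by blast
      then have "\<not> Pow Z \<subseteq> old" using card_of_mono1 not_ordLess_ordLeq by blast
      then obtain X where X: "X \<subseteq> Z" "X \<notin> old" by blast
      obtain b' c' where p: "pattern (M t) \<phi> k m S Z b' c'" using True unfolding pat_def by blast
      have Mt: "elem_submodel V (M t) N1"
        using sub[of t i] True rrefl[OF i] N1(1) elem_submodel_trans by blast
      obtain N2 where N2: "elem_submodel V N1 N2" "|univ N2| =o lam"
        "\<And>P. univ (M t) \<subseteq> univ P \<Longrightarrow> univ P \<subseteq> univ N1 \<Longrightarrow> X \<in> coded P N2"
        using extension_code[OF lam big str1 N1(2) b phi Mt p Z(1) X(1)] unfolding coded_def by blast
      have "X \<in> coded (M \<alpha>) N2 \<and> X \<notin> coded (M \<alpha>) (M i)" if "(t, \<alpha>) \<in> r" "(\<alpha>, i) \<in> r" for \<alpha>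
      proof
        have "univ (M t) \<subseteq> univ (M \<alpha>)" "univ (M \<alpha>) \<subseteq> univ (M i)" "univ (M i) \<subseteq> univ N1"
          using sub[OF that] sub[OF that(2) rrefl[OF i]] N1(1) elem_submodel_univ by blast+
        then show "X \<in> coded (M \<alpha>) N2" using N2(3) by blast
        show "X \<notin> coded (M \<alpha>) (M i)" using X(2) that(2) unfolding old_def by (auto simp: under_def)
      qed
      moreover have MN2: "elem_submodel V (M i) N2" using N1(1) N2(1) by (rule elem_submodel_trans)
      ultimately show ?thesis
        using elem_submodel_EC_card[OF T Mi(1) MN2 N2(2)] pat_mono[OF N2(1) p1] unfolding Q_def by blast
    qed
  qed
  \<comment> \<open>\<open>Q\<close> consults the sequence only up to \<open>i\<close>, the part
    that a strategy is shown.\<close>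
  have Q_restrict: "Q i (restrict M (under r i)) N \<longleftrightarrow> Q i M N" if i: "i \<in> Field r" for i M N
  proof -
    have "restrict M (under r i) i = M i" using rrefl[OF i] by (simp add: under_def)
    moreover have "restrict M (under r i) \<alpha> = M \<alpha>" if "(\<alpha>, i) \<in> r" for \<alpha> using that by (simp add: under_def)
    ultimately show ?thesis unfolding Q_def by (metis (no_types, lifting))
  qed
  have QF: "Q i M (F i (restrict M (under r i)))"
    if "i \<in> Field r" "incr_cont V r (under r i) M"
      "\<And>j. j \<in> under r i \<Longrightarrow> M j \<in> EC_card V T lam" for i M
  proof -
    have "Q i (restrict M (under r i)) (F i (restrict M (under r i)))"
      unfolding F_def by (rule someI_ex) (use ex[OF that] Q_restrict[OF that(1)] in blast)
    then show ?thesis using Q_restrict[OF that(1)] by blast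
  qed
  have Pr: "Pr_seq V lam \<kappa> M"
    if inc: "incr_cont V r (Field r) M" and EC: "\<And>i. i \<in> Field r \<Longrightarrow> M i \<in> EC_card V T lam"
      and ob: "obeys V r F M" for M
  proof -
    have sub: "elem_submodel V (M i) (M j)" if "(i, j) \<in> r" for i j
      using inc that Fld[OF that] unfolding incr_cont_def by blast
    have QFi: "Q i M (F i (restrict M (under r i)))" if i: "i \<in> Field r" for i
    proof (rule QF[OF i])
      have "under r i \<subseteq> Field r" by (auto simp: under_def Field_def)
      then show "incr_cont V r (under r i) M" using inc unfolding incr_cont_def by (meson subsetD)
    qed (use EC Fld in \<open>auto simp: under_def\<close>)
    have next_model: "\<exists>N. Q (osuc r i) M N \<and> elem_submodel V N (M (osuc r (osuc r i)))"
      if i: "i \<in> Field r" for i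
      using QFi[OF osuc(1)[OF i]] ob i unfolding obeys_def by blast
    have patt: "pat (M t)" using next_model[OF z] pat_mono unfolding Q_def t_def by blast
    \<comment> \<open>The club is the final segment from \<open>t\<close> on, where the pattern is
      present.\<close>
    define E where "E = {\<alpha> \<in> Field r. (t, \<alpha>) \<in> r}"
    have cofE: "cofinal E r"
      unfolding cofinal_def
    proof
      fix i assume i: "i \<in> Field r"
      define j where "j = (if (i, t) \<in> r then t else i)"
      have j: "j \<in> Field r" "(i, j) \<in> r" "(t, j) \<in> r"
        using i t rrefl wo_rel.TOTALS[OF wo] by (auto simp: j_def)
      have "i \<noteq> osuc r j" using osuc(2,3)[OF j(1)] j(2) wo_rel.ANTISYM[OF wo] by (metis antisymD)
      then show "\<exists>b\<in>E. i \<noteq> b \<and> (i, b) \<in> r"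
        using osuc(1,2)[OF j(1)] j rtrans unfolding E_def by blast
    qed
    have clubE: "club r E"
      unfolding club_def
    proof (intro conjI ballI impI)
      fix \<delta> assume "\<delta> \<in> Field r" and lim: "is_limit r \<delta> \<and> (\<forall>i \<in> underS r \<delta>. \<exists>j \<in> E \<inter> underS r \<delta>. i \<in> underS r j)"
      then obtain j where "j \<in> E" "j \<in> underS r \<delta>" unfolding is_limit_def by blast
      then show "\<delta> \<in> E" using \<open>\<delta> \<in> Field r\<close> rtrans unfolding E_def underS_def by blast
    qed (use cofE in \<open>auto simp: E_def\<close>)
    have "\<not> (\<exists>\<pi>. automorphism V (M \<alpha>) \<pi> \<and>
        move_tp \<pi> ` realized_tps V (M \<alpha>) (M \<delta>1) = realized_tps V (M \<alpha>) (M \<delta>2))"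
      if a: "\<alpha> \<in> E" and d2: "has_cof r \<delta>2 \<kappa>" and ord: "\<alpha> \<in> underS r \<delta>1" "\<delta>1 \<in> underS r \<delta>2" for \<alpha> \<delta>1 \<delta>2
    proof
      assume "\<exists>\<pi>. automorphism V (M \<alpha>) \<pi> \<and>
        move_tp \<pi> ` realized_tps V (M \<alpha>) (M \<delta>1) = realized_tps V (M \<alpha>) (M \<delta>2)"
      then obtain \<pi> where \<pi>: "bij_betw \<pi> (univ (M \<alpha>)) (univ (M \<alpha>))"
        "move_tp \<pi> ` realized_tps V (M \<alpha>) (M \<delta>1) = realized_tps V (M \<alpha>) (M \<delta>2)"
        unfolding automorphism_def by blast
      \<comment> \<open>The move after \<open>\<delta>1\<close> is used, as obedience speaks of
        successor indices. Its answer lies inside \<open>M (osuc r i)\<close>, which is still below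
        \<open>M \<delta>2\<close> because \<open>\<delta>2\<close> has a cofinality.\<close>
      define i where "i = osuc r \<delta>1"
      have ad: "(\<alpha>, \<delta>1) \<in> r" using ord by (simp add: underS_def)
      have d1: "\<delta>1 \<in> Field r" using Fld[OF ad] by simp
      have i: "(\<delta>1, i) \<in> r" "(osuc r i, \<delta>2) \<in> r"
        using osuc(2)[OF d1] has_cof_osuc[OF r d2 has_cof_osuc[OF r d2 ord(2)]]
        by (auto simp: i_def underS_def)
      have ai: "(\<alpha>, i) \<in> r" "(t, \<alpha>) \<in> r" using rtrans[OF ad i(1)] a by (auto simp: E_def)
      obtain N where QN: "Q i M N" and NM: "elem_submodel V N (M (osuc r i))"
        using next_model[OF d1] unfolding i_def by blast
      obtain X where X: "X \<in> coded (M \<alpha>) N" "X \<notin> coded (M \<alpha>) (M i)"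
        using QN patt ai rtrans unfolding Q_def by blast
      have aN: "univ (M \<alpha>) \<subseteq> univ (M i)" "univ (M i) \<subseteq> univ N" "univ (M \<alpha>) \<subseteq> univ (M \<delta>1)"
        using sub[OF ai(1)] sub[OF ad] QN elem_submodel_univ unfolding Q_def by blast+
      \<comment> \<open>\<open>X\<close> is carried up from \<open>N\<close> to
        \<open>M \<delta>2\<close>, back by \<open>\<pi>\<close> to \<open>M \<delta>1\<close>, and
        up again to \<open>M i\<close>, where it was chosen not to be coded.\<close>
      have "X \<in> coded (M \<alpha>) (M \<delta>2)"
        using codes_mono[OF elem_submodel_trans[OF NM sub[OF i(2)]] phi] aN X(1) unfolding coded_def by blast
      then have "X \<in> coded (M \<alpha>) (M \<delta>1)"
        using codes_invariant[OF \<pi>(1) phi \<pi>(2)] unfolding coded_def by blast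
      then have "X \<in> coded (M \<alpha>) (M i)"
        using codes_mono[OF sub[OF i(1)] phi aN(3)] unfolding coded_def by blast
      then show False using X(2) by blast
    qed
    then show ?thesis
      using inc EC clubE unfolding Pr_seq_def r_def[symmetric] EC_card_def cof_points_def by blast
  qed
  show ?thesis
    unfolding Pr_theory_def r_def[symmetric]
  proof (intro exI[of _ F] conjI ballI allI impI)
    fix i and M :: "'l set \<Rightarrow> ('f, 'r, 'a) struct"
    assume i: "i \<in> Field r" and M: "incr_cont V r (under r i) M \<and> (\<forall>j\<in>under r i. M j \<in> EC_card V T lam)"
    show "F i (restrict M (under r i)) \<in> EC_card V T lam"
      "elem_submodel V (M i) (F i (restrict M (under r i)))"
      using QF[OF i, of M] M unfolding Q_def by blast+
  qed (use Pr in blast)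
qed

section \<open>Shattering from independence (\<open>k = 1\<close>) and from strong independence
  (\<open>m = 1\<close>)\<close>

lemma independent_shatters:
  assumes ind: "independent_theory TYPE('a) V T"
  shows "\<exists>m. \<exists>\<phi> \<in> formulas V (1 + m). \<forall>M \<in> (EC V T :: ('f, 'r, 'a) struct set). shatters M \<phi> 1 m"
proof -
  obtain m \<phi> where phi: "\<phi> \<in> formulas V (Suc m)" and
    h: "\<forall>n. \<forall>M \<in> (EC V T :: ('f, 'r, 'a) struct set). \<exists>b :: nat \<Rightarrow> 'a list.
          (\<forall>l < n. b l \<in> lists (univ M) \<and> length (b l) = m) \<and>
          (\<forall>u \<subseteq> {..<n}. \<exists>x \<in> univ M.
             (\<forall>l \<in> u. holds M \<phi> (x # b l)) \<and>
             (\<forall>l < n. l \<notin> u \<longrightarrow> holds M (Neg \<phi>) (x # b l)))"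
    using ind unfolding independent_theory_def by (elim exE bexE) (rule that)
  have "shatters M \<phi> 1 m" if M: "M \<in> EC V T" for M :: "('f, 'r, 'a) struct"
    unfolding shatters_def
  proof
    fix n :: nat
    obtain b where b: "\<forall>l < n. b l \<in> lists (univ M) \<and> length (b l) = m"
      and u: "\<forall>u \<subseteq> {..<n}. \<exists>x \<in> univ M. (\<forall>l \<in> u. holds M \<phi> (x # b l)) \<and>
             (\<forall>l < n. l \<notin> u \<longrightarrow> holds M (Neg \<phi>) (x # b l))"
      using h[rule_format, OF M, of n] by (elim exE conjE) (rule that)
    have "\<exists>x \<in> lists (univ M). length x = 1 \<and> (\<forall>l < n. holds M \<phi> (x @ b l) \<longleftrightarrow> l \<in> v)"
      if v: "v \<subseteq> {..<n}" for v
    proof -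
      obtain x where "x \<in> univ M" "\<forall>l \<in> v. holds M \<phi> (x # b l)"
        "\<forall>l < n. l \<notin> v \<longrightarrow> holds M (Neg \<phi>) (x # b l)" using u[rule_format, OF v] by blast
      then show ?thesis by (intro bexI[of _ "[x]"]) (auto simp: holds_def)
    qed
    then show "\<exists>b. (\<forall>l < n. b l \<in> lists (univ M) \<and> length (b l) = m) \<and>
      (\<forall>u \<subseteq> {..<n}. \<exists>x \<in> lists (univ M). length x = 1 \<and> (\<forall>l < n. holds M \<phi> (x @ b l) \<longleftrightarrow> l \<in> u))"
      using b by blast
  qed
  then show ?thesis using phi by auto
qed

text \<open>Here single elements are cut out by tuples. An infinite model supplies \<open>n\<close>
  elements to be shattered and \<open>n\<close> fillers, so that even and odd positions can always
  be balanced.\<close>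

lemma strong_independence_shatters:
  assumes ind: "strong_independence_property TYPE('a) V T"
  shows "\<exists>m. \<exists>\<phi> \<in> formulas V (m + 1). \<forall>M \<in> (EC V T :: ('f, 'r, 'a) struct set).
    infinite (univ M) \<longrightarrow> shatters M \<phi> m 1"
proof -
  obtain m \<phi> where phi: "\<phi> \<in> formulas V (Suc m)" and
    h: "\<forall>M \<in> (EC V T :: ('f, 'r, 'a) struct set). \<forall>n. \<forall>a :: nat \<Rightarrow> 'a.
          a ` {..<2*n} \<subseteq> univ M \<and> inj_on a {..<2*n} \<longrightarrow>
          (\<exists>ys \<in> lists (univ M). length ys = m \<and>
             (\<forall>l < 2*n. (even l \<longrightarrow> holds M \<phi> (ys @ [a l])) \<and>
                        (odd l \<longrightarrow> holds M (Neg \<phi>) (ys @ [a l]))))"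
    using ind unfolding strong_independence_property_def by (elim exE bexE) (rule that)
  have "shatters M \<phi> m 1" if M: "M \<in> EC V T" and inf: "infinite (univ M)" for M :: "('f, 'r, 'a) struct"
    unfolding shatters_def
  proof
    fix n :: nat
    obtain f :: "nat \<Rightarrow> 'a" where f: "inj f" "range f \<subseteq> univ M"
      using inf infinite_countable_subset by blast
    text \<open>The element \<open>f (2 * l)\<close> goes to an even position if \<open>l \<in> v\<close> and is swapped with the filler
      \<open>f (2 * l + 1)\<close> otherwise.\<close>
    have "\<exists>x \<in> lists (univ M). length x = m \<and> (\<forall>l < n. holds M \<phi> (x @ [f (2 * l)]) \<longleftrightarrow> l \<in> v)" for v
    proof -
      define s where "s l = (if l div 2 \<in> v then l else if even l then l + 1 else l - 1)" for l :: nat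
      have ss: "s (s l) = l" for l
        by (cases "even l") (auto simp: s_def elim!: evenE oddE)
      have "inj s" using ss by (metis injI)
      then have inj: "inj_on (f \<circ> s) {..<2*n}" using f(1) by (meson inj_compose inj_on_subset subset_UNIV)
      have im: "(f \<circ> s) ` {..<2*n} \<subseteq> univ M" using f(2) by auto
      obtain ys where ys: "ys \<in> lists (univ M)" "length ys = m"
        and e: "\<And>l. l < 2*n \<Longrightarrow> even l \<Longrightarrow> holds M \<phi> (ys @ [f (s l)])"
        and o: "\<And>l. l < 2*n \<Longrightarrow> odd l \<Longrightarrow> \<not> holds M \<phi> (ys @ [f (s l)])"
        using h[rule_format, OF M conjI[OF im inj]] by (auto simp: holds_def)
      have "holds M \<phi> (ys @ [f (2 * l)]) \<longleftrightarrow> l \<in> v" if l: "l < n" for l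
      proof (cases "l \<in> v")
        case True
        then have "s (2 * l) = 2 * l" by (simp add: s_def)
        then show ?thesis using e[of "2 * l"] l True by simp
      next
        case False
        then have "s (2 * l + 1) = 2 * l" by (simp add: s_def)
        then show ?thesis using o[of "2 * l + 1"] l False by simp
      qed
      then show ?thesis using ys by blast
    qed
    then show "\<exists>b. (\<forall>l < n. b l \<in> lists (univ M) \<and> length (b l) = 1) \<and>
      (\<forall>u \<subseteq> {..<n}. \<exists>x \<in> lists (univ M). length x = m \<and> (\<forall>l < n. holds M \<phi> (x @ b l) \<longleftrightarrow> l \<in> u))"
      using f(2) by (intro exI[of _ "\<lambda>l. [f (2 * l)]"]) auto
  qed
  then show ?thesis using phi by auto
qed

theorem claim2p22:
  fixes V :: "('f, 'r) vocab"
    and T :: "('f, 'r) fm set"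
    and lam :: "'l rel"
    and \<kappa> :: "'k rel"
  assumes "complete_theory TYPE('a) V T"
    and "Card_order lam" and "cinfinite lam"
    and "Card_order \<kappa>" and "cinfinite \<kappa>" and "regularCard \<kappa>"
    and "\<kappa> \<le>o lam"
    and "lam ^c \<kappa> <o ctwo ^c cmin (ctwo ^c \<kappa>) lam"
    and "|T| <o lam"
    \<comment> \<open>the type of the elements of models is large enough to stand for the class of all sets\<close>
    and "cardSuc lam \<le>o |UNIV :: 'a set|"
  shows "(strong_independence_property TYPE('a) V T \<longrightarrow> Pr_theory TYPE('a) V T lam \<kappa>) \<and>
         (independent_theory TYPE('a) V T \<longrightarrow> Pr_theory TYPE('a) V T lam \<kappa>)"
proof -
  have Pr: "Pr_theory TYPE('a) V T lam \<kappa>"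
    if "\<phi> \<in> formulas V (k + m)"
      and "\<And>M :: ('f, 'r, 'a) struct. M \<in> EC V T \<Longrightarrow> infinite (univ M) \<Longrightarrow> shatters M \<phi> k m" for \<phi> k m
    using Pr_theory_of_shatters[OF assms(1) conjI[OF assms(3,2)] conjI[OF assms(5,4)] assms(7,8)
        ordLess_imp_ordLeq[OF assms(9)] assms(10) that] .
  show ?thesis
    using Pr strong_independence_shatters[where 'a = 'a, of V T] independent_shatters[where 'a = 'a, of V T]
    by blast
qed

end
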